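(* Let $\mathbb{F}$ be a finite field with $q$ elements, let $E/\mathbb{F}$ be an elliptic curve, and let $\mathbf{P}=(P_1,P_2)\in E(\mathbb{F})^2$ be such that $P_1,P_2\neq\mathcal{O}$, $P_2\pm P_1\neq\mathcal{O}$, and the order of $P_1$ is $r>3$. Let $(\Psi_n(\mathbf{P}))_{n\ge 0}$, $(\Phi_n(\mathbf{P}))_{n\ge 0}$, $(\overline{\Omega}_n(\mathbf{P}))_{n\ge 0}$ be the sequences of values of the translated division polynomials of $E$ at $\mathbf{P}$. Then these three sequences are purely periodic with periods $rt$, $rt'$ and $rt''$ respectively, for some integers $t,t',t''$ dividing $q-1$.
   Context: A sequence $(s_n)_{n\ge0}$ is purely periodic with period $\pi\ge1$ if $s_{n+\pi}=s_n$ for all $n\ge 0$. Translated division polynomials. Let $f^*(x,y)=y^2+\alpha_1xy+\alpha_3y-x^3-\alpha_2x^2-\alpha_4x-\alpha_6$ and $R^*=\mathbb{Z}[\alpha_1,\alpha_2,\alpha_3,\alpha_4,\alpha_6][x_1,y_1,x_2,y_2][(x_1-x_2)^{-1}]/\langle f^*(x_1,y_1),f^*(x_2,y_2)\rangle$, where $\alpha_i,x_i,y_i$ are indeterminates. Let $\beta_1=2y_1+\alpha_1x_1+\alpha_3$ and $\beta_2=3x_1^4+b_2x_1^3+3b_4x_1^2+3b_6x_1+b_8$ with $b_2,b_4,b_6,b_8$ the usual Weierstrass quantities attached to the $\alpha_i$. The elements $\Psi_n$ ($n\in\mathbb{Z}$) of the fraction field of $R^*$ are determined by $\Psi_{-1}=x_1-x_2$,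 $\Psi_0=\Psi_1=1$, $\Psi_2=2x_1+x_2-\left(\frac{y_2-y_1}{x_2-x_1}\right)^2-\alpha_1\frac{y_2-y_1}{x_2-x_1}+\alpha_2$, and the recurrence $\Psi_{m+2}\Psi_{m-2}=\beta_1^2\Psi_{m+1}\Psi_{m-1}-\beta_2\Psi_m^2$ for all $m\in\mathbb{Z}$. Further $\Phi_n=x_1\Psi_n^2-\Psi_{n+1}\Psi_{n-1}$ and $\overline{\Omega}_n=\left(\Psi_{n-1}^2\Psi_{n+2}-\Psi_{n-2}\Psi_{n+1}^2-\beta_1\Psi_n(\alpha_1\Phi_n+\alpha_3\Psi_n^2)\right)/(2\beta_1)$. All $\Psi_n,\Phi_n,\overline{\Omega}_n$ lie in $R^*$. For an elliptic curve $E/K$ over a field $K$, $y^2+a_1xy+a_3y=x^3+a_2x^2+a_4x+a_6$, and $\mathbf{P}=(P_1,P_2)\in E(K)^2$ with $P_1,P_2\ne\mathcal{O}$, $P_2\pm P_1\neq\mathcal{O}$, the values $\Psi_n(\mathbf{P}),\Phi_n(\mathbf{P}),\overline{\Omega}_n(\mathbf{P})\in K$ are the images under the ring homomorphism $R^*\to K$ with $\alpha_i\mapsto a_i$, $(x_i,y_i)\mapsto$ coordinates of $P_i$. When $[n]P_1+P_2\neq\mathcal{O}$ one has $[n]P_1+P_2=\left(\Phi_n(\mathbf{P})/\Psi_n(\mathbf{P})^2,\ \overline{\Omega}_n(\mathbf{P})/\Psi_n(\mathbf{P})^3\right)$. *)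

theory Defs
  imports Complex_Main
    "HOL-Library.Poly_Mapping"
    "HOL-Library.Cardinality"
    "HOL-Computational_Algebra.Fraction_Field"
begin

section \<open>Weierstrass curves and the group law\<close>

record 'a weierstrass =
  a1 :: 'a
  a2 :: 'a
  a3 :: 'a
  a4 :: 'a
  a6 :: 'a

definition weierstrass_poly :: "'a::comm_ring_1 weierstrass \<Rightarrow> 'a \<Rightarrow> 'a \<Rightarrow> 'a" where
  "weierstrass_poly E x y =
     y\<^sup>2 + a1 E * x * y + a3 E * y - x ^ 3 - a2 E * x\<^sup>2 - a4 E * x - a6 E"

definition b2 :: "'a::comm_ring_1 weierstrass \<Rightarrow> 'a" where
  "b2 E = (a1 E)\<^sup>2 + 4 * a2 E"

definition b4 :: "'a::comm_ring_1 weierstrass \<Rightarrow> 'a" where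
  "b4 E = 2 * a4 E + a1 E * a3 E"

definition b6 :: "'a::comm_ring_1 weierstrass \<Rightarrow> 'a" where
  "b6 E = (a3 E)\<^sup>2 + 4 * a6 E"

definition b8 :: "'a::comm_ring_1 weierstrass \<Rightarrow> 'a" where
  "b8 E = (a1 E)\<^sup>2 * a6 E + 4 * a2 E * a6 E - a1 E * a3 E * a4 E
            + a2 E * (a3 E)\<^sup>2 - (a4 E)\<^sup>2"

definition discriminant :: "'a::comm_ring_1 weierstrass \<Rightarrow> 'a" where
  "discriminant E = - ((b2 E)\<^sup>2 * b8 E) - 8 * (b4 E) ^ 3 - 27 * (b6 E)\<^sup>2 + 9 * b2 E * b4 E * b6 E"

definition elliptic_curve :: "'a::field weierstrass \<Rightarrow> bool" where
  "elliptic_curve E \<longleftrightarrow> discriminant E \<noteq> 0"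

datatype 'a point = Infinity | Affine (xcoord: 'a) (ycoord: 'a)

definition points :: "'a::field weierstrass \<Rightarrow> 'a point set" where
  "points E = insert Infinity {Affine x y | x y. weierstrass_poly E x y = 0}"

fun ec_neg :: "'a::field weierstrass \<Rightarrow> 'a point \<Rightarrow> 'a point" where
  "ec_neg E Infinity = Infinity"
| "ec_neg E (Affine x y) = Affine x (- y - a1 E * x - a3 E)"

fun ec_add :: "'a::field weierstrass \<Rightarrow> 'a point \<Rightarrow> 'a point \<Rightarrow> 'a point" where
  "ec_add E Infinity Q = Q"
| "ec_add E P Infinity = P"
| "ec_add E (Affine x1 y1) (Affine x2 y2) =
     (if x1 = x2 \<and> y1 + y2 + a1 E * x2 + a3 E = 0 then Infinity
      else
        let l = (if x1 = x2
                 then (3 * x1\<^sup>2 + 2 * a2 E * x1 + a4 E - a1 E * y1) / (2 * y1 + a1 E * x1 + a3 E)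
                 else (y2 - y1) / (x2 - x1));
            x3 = l\<^sup>2 + a1 E * l - a2 E - x1 - x2
        in Affine x3 (- (l + a1 E) * x3 - (y1 - l * x1) - a3 E))"

primrec ec_mult :: "'a::field weierstrass \<Rightarrow> nat \<Rightarrow> 'a point \<Rightarrow> 'a point" where
  "ec_mult E 0 P = Infinity"
| "ec_mult E (Suc n) P = ec_add E P (ec_mult E n P)"

(* Only used over finite fields, where every point has finite order. *)
definition ec_order :: "'a::field weierstrass \<Rightarrow> 'a point \<Rightarrow> nat" where
  "ec_order E P = (LEAST n. 0 < n \<and> ec_mult E n P = Infinity)"


section \<open>The ring \<open>R\<^sup>*\<close>\<close>

(* The indeterminate Inv12 is used to adjoin the inverse of x1 - x2, see in_ideal below. *)
datatype var = Alpha1 | Alpha2 | Alpha3 | Alpha4 | Alpha6 | X1 | Y1 | X2 | Y2 | Inv12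

type_synonym zpoly = "(var \<Rightarrow>\<^sub>0 nat) \<Rightarrow>\<^sub>0 int"

definition Var :: "var \<Rightarrow> zpoly" where
  "Var v = Poly_Mapping.single (Poly_Mapping.single v 1) 1"

definition curve_of :: "(var \<Rightarrow> 'a) \<Rightarrow> 'a weierstrass" where
  "curve_of a = \<lparr>a1 = a Alpha1, a2 = a Alpha2, a3 = a Alpha3, a4 = a Alpha4, a6 = a Alpha6\<rparr>"

(* Localising a ring A at an element s is realised as A[z] / (z s - 1); so R* is the
   quotient of the polynomial ring in ten variables by the ideal generated by the two
   curve equations and Inv12 * (x1 - x2) - 1. *)
definition in_ideal :: "zpoly \<Rightarrow> bool" where
  "in_ideal p \<longleftrightarrow> (\<exists>u v w.
     p = u * weierstrass_poly (curve_of Var) (Var X1) (Var Y1)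
       + v * weierstrass_poly (curve_of Var) (Var X2) (Var Y2)
       + w * (Var Inv12 * (Var X1 - Var X2) - 1))"

definition rstar_rel :: "zpoly \<Rightarrow> zpoly \<Rightarrow> bool" where
  "rstar_rel p q \<longleftrightarrow> in_ideal (p - q)"

lemma in_ideal_0: "in_ideal 0"
  unfolding in_ideal_def by (intro exI[of _ 0]) simp

lemma in_ideal_add:
  assumes "in_ideal p" "in_ideal q"
  shows "in_ideal (p + q)"
proof -
  from assms obtain u v w u' v' w' where
    "p = u * weierstrass_poly (curve_of Var) (Var X1) (Var Y1)
       + v * weierstrass_poly (curve_of Var) (Var X2) (Var Y2)
       + w * (Var Inv12 * (Var X1 - Var X2) - 1)"
    "q = u' * weierstrass_poly (curve_of Var) (Var X1) (Var Y1)
       + v' * weierstrass_poly (curve_of Var) (Var X2) (Var Y2)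
       + w' * (Var Inv12 * (Var X1 - Var X2) - 1)"
    unfolding in_ideal_def by blast
  hence "p + q = (u + u') * weierstrass_poly (curve_of Var) (Var X1) (Var Y1)
       + (v + v') * weierstrass_poly (curve_of Var) (Var X2) (Var Y2)
       + (w + w') * (Var Inv12 * (Var X1 - Var X2) - 1)"
    by (simp only: distrib_right) (simp only: ac_simps)
  thus ?thesis unfolding in_ideal_def by blast
qed

lemma in_ideal_mult:
  assumes "in_ideal p"
  shows "in_ideal (c * p)"
proof -
  from assms obtain u v w where
    "p = u * weierstrass_poly (curve_of Var) (Var X1) (Var Y1)
       + v * weierstrass_poly (curve_of Var) (Var X2) (Var Y2)
       + w * (Var Inv12 * (Var X1 - Var X2) - 1)"
    unfolding in_ideal_def by blast
  hence "c * p = (c * u) * weierstrass_poly (curve_of Var) (Var X1) (Var Y1)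
       + (c * v) * weierstrass_poly (curve_of Var) (Var X2) (Var Y2)
       + (c * w) * (Var Inv12 * (Var X1 - Var X2) - 1)"
    by (simp only: distrib_left mult.assoc)
  thus ?thesis unfolding in_ideal_def by blast
qed

lemma in_ideal_uminus: "in_ideal p \<Longrightarrow> in_ideal (- p)"
  using in_ideal_mult[of p "-1"] by simp

lemma in_ideal_diff: "in_ideal p \<Longrightarrow> in_ideal q \<Longrightarrow> in_ideal (p - q)"
  using in_ideal_add[of p "- q"] in_ideal_uminus[of q] by simp

quotient_type rstar = zpoly / rstar_rel
proof (rule equivpI)
  show "reflp rstar_rel" by (simp add: reflp_def rstar_rel_def in_ideal_0)
  show "symp rstar_rel"
    by (metis in_ideal_uminus minus_diff_eq rstar_rel_def sympI)
  show "transp rstar_rel"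
  proof (rule transpI)
    fix x y z assume "rstar_rel x y" "rstar_rel y z"
    thus "rstar_rel x z"
      using in_ideal_add[of "x - y" "y - z"] by (simp add: rstar_rel_def)
  qed
qed

instantiation rstar :: comm_ring
begin

lift_definition zero_rstar :: rstar is 0 .

lift_definition plus_rstar :: "rstar \<Rightarrow> rstar \<Rightarrow> rstar" is "(+)"
  unfolding rstar_rel_def by (metis add_diff_add in_ideal_add)

lift_definition uminus_rstar :: "rstar \<Rightarrow> rstar" is uminus
  unfolding rstar_rel_def by (metis in_ideal_uminus minus_diff_minus)

lift_definition minus_rstar :: "rstar \<Rightarrow> rstar \<Rightarrow> rstar" is "(-)"
  unfolding rstar_rel_def using in_ideal_diff
  by (metis (no_types, opaque_lifting) diff_diff_eq diff_diff_eq2 add_diff_eq add.commute diff_add_eq)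

lift_definition times_rstar :: "rstar \<Rightarrow> rstar \<Rightarrow> rstar" is "(*)"
proof -
  fix p p' q q' assume "rstar_rel p p'" "rstar_rel q q'"
  hence "in_ideal (q * (p - p') + p' * (q - q'))"
    unfolding rstar_rel_def by (intro in_ideal_add in_ideal_mult)
  moreover have "q * (p - p') + p' * (q - q') = p * q - p' * q'"
    by (simp add: algebra_simps)
  ultimately show "rstar_rel (p * q) (p' * q')" by (simp add: rstar_rel_def)
qed

instance
proof
  have eqI: "rstar_rel p q" if "p = q" for p q
    using that by (simp add: rstar_rel_def in_ideal_0)
  fix a b c :: rstar
  show "a + b + c = a + (b + c)" by transfer (rule eqI, simp add: algebra_simps)
  show "a + b = b + a" by transfer (rule eqI, simp add: algebra_simps)
  show "0 + a = a" by transfer (rule eqI, simp)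
  show "- a + a = 0" by transfer (rule eqI, simp)
  show "a - b = a + - b" by transfer (rule eqI, simp)
  show "a * b * c = a * (b * c)" by transfer (rule eqI, simp add: algebra_simps)
  show "a * b = b * a" by transfer (rule eqI, simp add: algebra_simps)
  show "(a + b) * c = a * c + b * c" by transfer (rule eqI, simp add: algebra_simps)
qed

end


text \<open>Evaluation of polynomials, used to show that \<open>R\<^sup>*\<close> is an integral domain and
  that homomorphisms out of it exist.\<close>

definition ring_homomorphism :: "('a::comm_ring_1 \<Rightarrow> 'b::comm_ring_1) \<Rightarrow> bool" where
  "ring_homomorphism h \<longleftrightarrow>
     h 1 = 1 \<and> (\<forall>x y. h (x + y) = h x + h y) \<and> (\<forall>x y. h (x * y) = h x * h y)"

lemma ring_homomorphismD:
  assumes "ring_homomorphism h"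
  shows "h 0 = 0" "h 1 = 1" "h (x + y) = h x + h y" "h (x * y) = h x * h y"
    "h (- x) = - h x" "h (x - y) = h x - h y" "h (x ^ n) = h x ^ n" "h (of_nat n) = of_nat n"
    "h (of_int k) = of_int k" "h (numeral w) = numeral w"
proof -
  show one: "h 1 = 1" and add: "h (x + y) = h x + h y" and mult: "h (x * y) = h x * h y" for x y
    using assms by (auto simp: ring_homomorphism_def)
  show zero: "h 0 = 0" using add[of 0 0] by simp
  show um: "h (- x) = - h x" for x
    using add[of x "- x"] zero by (simp add: eq_neg_iff_add_eq_0 add.commute)
  show "h (x - y) = h x - h y" using add[of x "- y"] um by simp
  show "h (x ^ n) = h x ^ n" by (induction n) (simp_all add: one mult)
  show nat: "h (of_nat n) = of_nat n" for n by (induction n) (simp_all add: zero one add)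
  show "h (of_int k) = of_int k" by (cases k rule: int_cases2) (simp_all add: nat um)
  show "h (numeral w) = numeral w" using nat[of "numeral w"] by simp
qed

lemma UNIV_var: "UNIV = {Alpha1, Alpha2, Alpha3, Alpha4, Alpha6, X1, Y1, X2, Y2, Inv12}"
  using var.exhaust by auto

instance var :: finite
  by standard (simp add: UNIV_var)

fun var_index :: "var \<Rightarrow> nat" where
  "var_index Alpha1 = 0" | "var_index Alpha2 = 1" | "var_index Alpha3 = 2"
| "var_index Alpha4 = 3" | "var_index Alpha6 = 4" | "var_index X1 = 5" | "var_index Y1 = 6"
| "var_index X2 = 7" | "var_index Y2 = 8" | "var_index Inv12 = 9"

(* The order is only needed to obtain the instance zpoly :: idom. *)
instantiation var :: linorder
begin
definition "v \<le> w \<longleftrightarrow> var_index v \<le> var_index w"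
definition "v < w \<longleftrightarrow> var_index v < var_index w"
instance
proof
  fix v w :: var
  show "v = w" if "v \<le> w" "w \<le> v"
    using that unfolding less_eq_var_def by (cases v; cases w; simp)
qed (auto simp: less_eq_var_def less_var_def)
end

definition mon_eval :: "(var \<Rightarrow> 'a::comm_ring_1) \<Rightarrow> (var \<Rightarrow>\<^sub>0 nat) \<Rightarrow> 'a" where
  "mon_eval a m = (\<Prod>v\<in>UNIV. a v ^ Poly_Mapping.lookup m v)"

definition poly_eval :: "(var \<Rightarrow> 'a::comm_ring_1) \<Rightarrow> zpoly \<Rightarrow> 'a" where
  "poly_eval a p =
     (\<Sum>m\<in>Poly_Mapping.keys p. of_int (Poly_Mapping.lookup p m) * mon_eval a m)"

lemma mon_eval_add: "mon_eval a (m + n) = mon_eval a m * mon_eval a n"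
  by (simp add: mon_eval_def lookup_add power_add prod.distrib)

lemma poly_eval_superset:
  assumes "finite S" "Poly_Mapping.keys p \<subseteq> S"
  shows "poly_eval a p = (\<Sum>m\<in>S. of_int (Poly_Mapping.lookup p m) * mon_eval a m)"
  unfolding poly_eval_def using assms
  by (intro sum.mono_neutral_left) (auto simp: in_keys_iff)

lemma poly_eval_add: "poly_eval a (p + q) = poly_eval a p + poly_eval a q"
proof -
  let ?S = "Poly_Mapping.keys p \<union> Poly_Mapping.keys q"
  have "finite ?S" by simp
  moreover have "Poly_Mapping.keys (p + q) \<subseteq> ?S" by (rule keys_add)
  ultimately show ?thesis
    by (simp add: poly_eval_superset[of ?S] lookup_add distrib_right sum.distrib)
qed

lemma poly_eval_single: "poly_eval a (Poly_Mapping.single m c) = of_int c * mon_eval a m"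
  by (cases "c = 0") (simp_all add: poly_eval_def)

lemma poly_eval_0: "poly_eval a 0 = 0"
  by (simp add: poly_eval_def)

lemma poly_eval_1: "poly_eval a 1 = 1"
  using poly_eval_single[of a 0 1] by (simp add: mon_eval_def)

lemma zpoly_induct [case_names single add]:
  fixes p :: zpoly
  assumes single: "\<And>m c. Q (Poly_Mapping.single m c)"
    and add: "\<And>p q. Q p \<Longrightarrow> Q q \<Longrightarrow> Q (p + q)"
  shows "Q p"
proof (induction p rule: update_induct)
  case const
  show ?case using single[of _ 0] by simp
next
  case (update f m c)
  have "Poly_Mapping.update m c f = f + Poly_Mapping.single m c"
    using update by (intro poly_mapping_eqI)
      (auto simp: lookup_update lookup_add lookup_single when_def in_keys_iff)
  thus ?case using add[OF update.IH single] by simp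
qed

lemma poly_eval_mult: "poly_eval a (p * q) = poly_eval a p * poly_eval a q"
proof (induction p rule: zpoly_induct)
  case (single m c)
  show ?case
  proof (induction q rule: zpoly_induct)
    case (single n d)
    show ?case by (simp add: mult_single poly_eval_single mon_eval_add)
  next
    case (add q1 q2)
    thus ?case by (simp add: distrib_left poly_eval_add)
  qed
next
  case (add p1 p2)
  thus ?case by (simp add: distrib_right poly_eval_add)
qed

lemma ring_homomorphism_poly_eval: "ring_homomorphism (poly_eval a)"
  by (simp add: ring_homomorphism_def poly_eval_1 poly_eval_add poly_eval_mult)

lemmas poly_eval_simps = ring_homomorphismD[OF ring_homomorphism_poly_eval]

lemma poly_eval_Var: "poly_eval a (Var v) = a v"
proof -
  have "mon_eval a (Poly_Mapping.single v 1) = (\<Prod>w\<in>UNIV. if w = v then a v else 1)"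
    unfolding mon_eval_def by (intro prod.cong) (auto simp: lookup_single when_def)
  thus ?thesis by (simp add: Var_def poly_eval_single)
qed

lemma single_eq_prod_Var:
  "Poly_Mapping.single m c = of_int c * (\<Prod>v\<in>UNIV. Var v ^ Poly_Mapping.lookup m v)"
proof -
  have pow: "Var v ^ n = Poly_Mapping.single (Poly_Mapping.single v n) 1" for v n
    by (induction n) (simp_all add: Var_def mult_single flip: single_add)
  have prod: "(\<Prod>v\<in>A. Poly_Mapping.single (g v) (1::int)) = Poly_Mapping.single (sum g A) 1"
    if "finite A" for A and g :: "var \<Rightarrow> var \<Rightarrow>\<^sub>0 nat"
    using that by (induction A) (simp_all add: mult_single)
  have "(\<Sum>v\<in>UNIV. Poly_Mapping.single v (Poly_Mapping.lookup m v)) = m"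
    by (rule poly_mapping_eqI) (simp add: lookup_sum lookup_single when_def)
  hence "(\<Prod>v\<in>UNIV. Var v ^ Poly_Mapping.lookup m v) = Poly_Mapping.single m 1"
    by (simp add: pow prod)
  moreover have "(of_int c :: zpoly) = Poly_Mapping.single 0 c" 
    using single_of_int[of c, where 'a = "var \<Rightarrow>\<^sub>0 nat" and 'b = int] by (simp add: of_int_eq_id)
  ultimately show ?thesis by (simp only: mult_single) simp
qed

text \<open>A subset of the polynomial ring that contains the variables and is closed under the
  ring operations is everything.\<close>

lemma zpoly_subring_induct [case_names Var int add mult]:
  fixes p :: zpoly
  assumes V: "\<And>v. Q (Var v)" and int: "\<And>c. Q (of_int c)"
    and add: "\<And>p q. Q p \<Longrightarrow> Q q \<Longrightarrow> Q (p + q)"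
    and mult: "\<And>p q. Q p \<Longrightarrow> Q q \<Longrightarrow> Q (p * q)"
  shows "Q p"
proof (induction p rule: zpoly_induct)
  case (single m c)
  have pow: "Q (Var v ^ n)" for v n
    using int[of 1] by (induction n) (auto intro: V mult)
  have "Q (\<Prod>v\<in>A. Var v ^ Poly_Mapping.lookup m v)" if "finite A" for A
    using that int[of 1] by (induction A) (auto intro: pow mult)
  thus ?case by (subst single_eq_prod_Var) (auto intro: mult int)
qed (auto intro: add)

lemma ring_homomorphism_eq_poly_eval:
  assumes h: "ring_homomorphism h"
  shows "h p = poly_eval (\<lambda>v. h (Var v)) p"
  by (induction p rule: zpoly_subring_induct)
     (simp_all add: ring_homomorphismD[OF h] poly_eval_simps poly_eval_Var)

definition admissible :: "(var \<Rightarrow> 'a::comm_ring_1) \<Rightarrow> bool" where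
  "admissible a \<longleftrightarrow> weierstrass_poly (curve_of a) (a X1) (a Y1) = 0 \<and>
     weierstrass_poly (curve_of a) (a X2) (a Y2) = 0 \<and> a Inv12 * (a X1 - a X2) = 1"

lemma poly_eval_ideal:
  assumes "admissible a" "in_ideal p"
  shows "poly_eval a p = 0"
  using assms unfolding in_ideal_def admissible_def weierstrass_poly_def curve_of_def
  by (auto simp: poly_eval_simps poly_eval_Var)

lemma Var_eq_iff: "Var v = Var w \<longleftrightarrow> v = w"
proof
  assume "Var v = Var w"
  hence "poly_eval (\<lambda>u. if u = v then 1 else 0 :: int) (Var v) =
         poly_eval (\<lambda>u. if u = v then 1 else 0) (Var w)" by simp
  thus "v = w" by (simp add: poly_eval_Var split: if_splits)
qed simp

definition emb :: "zpoly \<Rightarrow> zpoly fract" where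
  "emb p = Fract p 1"

lemma ring_homomorphism_emb: "ring_homomorphism emb"
  by (simp add: ring_homomorphism_def emb_def One_fract_def)

lemmas emb_simps = ring_homomorphismD[OF ring_homomorphism_emb]

lemma emb_eq_0_iff: "emb p = 0 \<longleftrightarrow> p = 0"
  by (simp add: emb_def Zero_fract_def eq_fract)

text \<open>Since \<open>x\<^sub>1 - x\<^sub>2\<close> is inverted, the two curve equations can be solved for
  \<open>\<alpha>\<^sub>4\<close> and \<open>\<alpha>\<^sub>6\<close>; this exhibits the ideal as the kernel of a map into a field.\<close>

definition elim_c :: "var \<Rightarrow> var \<Rightarrow> zpoly" where
  "elim_c x y = (Var y)\<^sup>2 + Var Alpha1 * Var x * Var y + Var Alpha3 * Var y
                  - Var x ^ 3 - Var Alpha2 * (Var x)\<^sup>2"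

definition elim_subst :: "var \<Rightarrow> zpoly fract" where
  "elim_subst v =
    (let a4 = (emb (elim_c X1 Y1) - emb (elim_c X2 Y2)) / (emb (Var X1) - emb (Var X2)) in
     if v = Alpha4 then a4
     else if v = Alpha6 then emb (elim_c X1 Y1) - a4 * emb (Var X1)
     else if v = Inv12 then 1 / (emb (Var X1) - emb (Var X2))
     else emb (Var v))"

lemma emb_X1_X2: "emb (Var X1) - emb (Var X2) \<noteq> 0"
  using emb_eq_0_iff[of "Var X1 - Var X2"] by (simp add: emb_simps Var_eq_iff)

lemma admissible_elim_subst: "admissible elim_subst"
proof -
  let ?c1 = "emb (elim_c X1 Y1)" and ?c2 = "emb (elim_c X2 Y2)"
  let ?x1 = "emb (Var X1)" and ?x2 = "emb (Var X2)"
  define A where "A = (?c1 - ?c2) / (?x1 - ?x2)"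
  have A: "A * (?x1 - ?x2) = ?c1 - ?c2"
    using emb_X1_X2 by (simp add: A_def)
  have "?c2 - A * ?x2 - (?c1 - A * ?x1) = 0"
    using A by (simp add: algebra_simps)
  moreover have "weierstrass_poly (curve_of elim_subst) (elim_subst X1) (elim_subst Y1) = 
     ?c1 - A * ?x1 - (?c1 - A * ?x1)"
    unfolding weierstrass_poly_def curve_of_def
    by (simp add: elim_subst_def A_def Let_def elim_c_def emb_simps)
  moreover have "weierstrass_poly (curve_of elim_subst) (elim_subst X2) (elim_subst Y2) = 
     ?c2 - A * ?x2 - (?c1 - A * ?x1)"
    unfolding weierstrass_poly_def curve_of_def
    by (simp add: elim_subst_def A_def Let_def elim_c_def emb_simps)
  moreover have "elim_subst Inv12 * (elim_subst X1 - elim_subst X2) = 1"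
    using emb_X1_X2 by (simp add: elim_subst_def Let_def)
  ultimately show ?thesis by (simp add: admissible_def)
qed

lemma elim_reduce:
  "\<exists>k q. poly_eval elim_subst q = emb q \<and> in_ideal ((Var X1 - Var X2) ^ k * p - q)"
proof -
  let ?d = "Var X1 - Var X2"
  have gen: "in_ideal (weierstrass_poly (curve_of Var) (Var X1) (Var Y1))"
            "in_ideal (weierstrass_poly (curve_of Var) (Var X2) (Var Y2))"
            "in_ideal (Var Inv12 * ?d - 1)"
    unfolding in_ideal_def
    by (rule exI[of _ 1], rule exI[of _ 0], rule exI[of _ 0], simp)
       (rule exI[of _ 0], rule exI[of _ 1], rule exI[of _ 0], simp,
        rule exI[of _ 0], rule exI[of _ 0], rule exI[of _ 1], simp)
  have subst_Var: "poly_eval elim_subst (Var v) = emb (Var v)" if "v \<notin> {Alpha4, Alpha6, Inv12}" for v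
    using that by (simp add: poly_eval_Var elim_subst_def Let_def)
  have subst_c: "poly_eval elim_subst (elim_c X1 Y1) = emb (elim_c X1 Y1)"
                "poly_eval elim_subst (elim_c X2 Y2) = emb (elim_c X2 Y2)"
    by (simp_all add: elim_c_def poly_eval_simps emb_simps subst_Var)
  have w: "weierstrass_poly (curve_of Var) (Var X1) (Var Y1) = elim_c X1 Y1 - Var Alpha4 * Var X1 - Var Alpha6"
          "weierstrass_poly (curve_of Var) (Var X2) (Var Y2) = elim_c X2 Y2 - Var Alpha4 * Var X2 - Var Alpha6"
    by (simp_all add: weierstrass_poly_def curve_of_def elim_c_def)
  show ?thesis
  proof (induction p rule: zpoly_subring_induct)
    case (Var v)
    have "v = Alpha4 \<or> v = Alpha6 \<or> v = Inv12 \<or> v \<notin> {Alpha4, Alpha6, Inv12}" by blast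
    thus ?case
    proof (elim disjE)
      assume v: "v = Alpha4"
      have "in_ideal (weierstrass_poly (curve_of Var) (Var X2) (Var Y2)
                      - weierstrass_poly (curve_of Var) (Var X1) (Var Y1))"
        by (intro in_ideal_diff gen)
      also have "weierstrass_poly (curve_of Var) (Var X2) (Var Y2)
                      - weierstrass_poly (curve_of Var) (Var X1) (Var Y1)
               = ?d ^ 1 * Var v - (elim_c X1 Y1 - elim_c X2 Y2)"
        unfolding w v by (simp add: algebra_simps)
      finally show ?case
        by (intro exI[of _ 1] exI[of _ "elim_c X1 Y1 - elim_c X2 Y2"])
           (simp add: poly_eval_simps emb_simps subst_c)
    next
      assume v: "v = Alpha6"
      let ?q = "Var X1 * elim_c X2 Y2 - Var X2 * elim_c X1 Y1"
      have "in_ideal (Var X2 * weierstrass_poly (curve_of Var) (Var X1) (Var Y1)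
                      - Var X1 * weierstrass_poly (curve_of Var) (Var X2) (Var Y2))"
        by (intro in_ideal_diff in_ideal_mult gen)
      also have "Var X2 * weierstrass_poly (curve_of Var) (Var X1) (Var Y1)
                      - Var X1 * weierstrass_poly (curve_of Var) (Var X2) (Var Y2)
               = ?d ^ 1 * Var v - ?q"
        unfolding w v by (simp add: algebra_simps)
      finally show ?case
        by (intro exI[of _ 1] exI[of _ ?q])
           (simp add: poly_eval_simps emb_simps subst_c subst_Var)
    next
      assume v: "v = Inv12"
      have "in_ideal (?d ^ 1 * Var v - 1)"
        using gen(3) unfolding v by (simp add: mult.commute)
      thus ?case
        by (intro exI[of _ 1] exI[of _ 1]) (simp add: poly_eval_simps emb_simps)
    next
      assume v: "v \<notin> {Alpha4, Alpha6, Inv12}"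
      show ?case
        using v by (intro exI[of _ "0::nat"] exI[of _ "Var v"]) (simp add: subst_Var in_ideal_0)
    qed
  next
    case (int c)
    show ?case
      by (intro exI[of _ "0::nat"] exI[of _ "of_int c"]) (simp add: poly_eval_simps emb_simps in_ideal_0)
  next
    case (add p1 p2)
    then obtain k1 q1 k2 q2 where
      1: "poly_eval elim_subst q1 = emb q1" "in_ideal (?d ^ k1 * p1 - q1)" and
      2: "poly_eval elim_subst q2 = emb q2" "in_ideal (?d ^ k2 * p2 - q2)" by blast
    have "in_ideal (?d ^ k2 * (?d ^ k1 * p1 - q1) + ?d ^ k1 * (?d ^ k2 * p2 - q2))"
      by (intro in_ideal_add in_ideal_mult 1 2)
    also have "?d ^ k2 * (?d ^ k1 * p1 - q1) + ?d ^ k1 * (?d ^ k2 * p2 - q2)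
             = ?d ^ (k1 + k2) * (p1 + p2) - (?d ^ k2 * q1 + ?d ^ k1 * q2)"
      by (simp add: algebra_simps power_add)
    finally show ?case
      by (intro exI[of _ "k1 + k2"] exI[of _ "?d ^ k2 * q1 + ?d ^ k1 * q2"])
         (simp add: poly_eval_simps emb_simps subst_Var 1 2)
  next
    case (mult p1 p2)
    then obtain k1 q1 k2 q2 where
      1: "poly_eval elim_subst q1 = emb q1" "in_ideal (?d ^ k1 * p1 - q1)" and
      2: "poly_eval elim_subst q2 = emb q2" "in_ideal (?d ^ k2 * p2 - q2)" by blast
    have "in_ideal ((?d ^ k2 * p2) * (?d ^ k1 * p1 - q1) + q1 * (?d ^ k2 * p2 - q2))"
      by (intro in_ideal_add in_ideal_mult 1 2)
    also have "(?d ^ k2 * p2) * (?d ^ k1 * p1 - q1) + q1 * (?d ^ k2 * p2 - q2)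
             = ?d ^ (k1 + k2) * (p1 * p2) - q1 * q2"
      by (simp add: algebra_simps power_add)
    finally show ?case
      by (intro exI[of _ "k1 + k2"] exI[of _ "q1 * q2"])
         (simp add: poly_eval_simps emb_simps 1 2)
  qed
qed

lemma in_ideal_iff: "in_ideal p \<longleftrightarrow> poly_eval elim_subst p = 0"
proof
  assume "in_ideal p"
  thus "poly_eval elim_subst p = 0" by (rule poly_eval_ideal[OF admissible_elim_subst])
next
  assume p: "poly_eval elim_subst p = 0"
  let ?d = "Var X1 - Var X2"
  obtain k q where q: "poly_eval elim_subst q = emb q" "in_ideal (?d ^ k * p - q)"
    using elim_reduce by blast
  have "poly_eval elim_subst (?d ^ k * p - q) = 0"
    by (rule poly_eval_ideal[OF admissible_elim_subst q(2)])
  hence "emb q = 0" using q(1) p by (simp add: poly_eval_simps)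
  hence *: "in_ideal (?d ^ k * p)" using q(2) by (simp add: emb_eq_0_iff)
  have gen: "in_ideal (Var Inv12 * ?d - 1)"
    unfolding in_ideal_def
    by (rule exI[of _ 0], rule exI[of _ 0], rule exI[of _ 1], simp)
  from * show "in_ideal p"
  proof (induction k)
    case (Suc k)
    have "in_ideal (Var Inv12 * (?d ^ Suc k * p) - (?d ^ k * p) * (Var Inv12 * ?d - 1))"
      by (intro in_ideal_diff in_ideal_mult gen Suc.prems)
    also have "Var Inv12 * (?d ^ Suc k * p) - (?d ^ k * p) * (Var Inv12 * ?d - 1) = ?d ^ k * p"
      by (simp add: algebra_simps)
    finally show ?case by (rule Suc.IH)
  qed simp
qed

instantiation rstar :: idom
begin

lift_definition one_rstar :: rstar is 1 .

instance
proof
  have eqI: "rstar_rel p q" if "p = q" for p q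
    using that by (simp add: rstar_rel_def in_ideal_0)
  fix a b :: rstar
  show "1 * a = a" by transfer (rule eqI, simp)
  show "(0::rstar) \<noteq> 1"
    by transfer (simp add: rstar_rel_def in_ideal_iff poly_eval_simps)
  show "a * b \<noteq> 0" if "a \<noteq> 0" "b \<noteq> 0"
    using that by transfer (simp add: rstar_rel_def in_ideal_iff poly_eval_simps)
qed

end


section \<open>Translated division polynomials\<close>

definition gen :: "var \<Rightarrow> rstar" where
  "gen v = abs_rstar (Var v)"

definition of_rstar :: "rstar \<Rightarrow> rstar fract" where
  "of_rstar r = Fract r 1"

definition fgen :: "var \<Rightarrow> rstar fract" where
  "fgen v = of_rstar (gen v)"

definition beta1 :: "rstar fract" where
  "beta1 = 2 * fgen Y1 + fgen Alpha1 * fgen X1 + fgen Alpha3"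

definition beta2 :: "rstar fract" where
  "beta2 = (let E = curve_of fgen; x = fgen X1 in
     3 * x ^ 4 + b2 E * x ^ 3 + 3 * b4 E * x\<^sup>2 + 3 * b6 E * x + b8 E)"

definition Psi2 :: "rstar fract" where
  "Psi2 = (let l = (fgen Y2 - fgen Y1) / (fgen X2 - fgen X1) in
     2 * fgen X1 + fgen X2 - l\<^sup>2 - fgen Alpha1 * l + fgen Alpha2)"

definition is_Psi :: "(int \<Rightarrow> rstar fract) \<Rightarrow> bool" where
  "is_Psi s \<longleftrightarrow>
     s (-1) = fgen X1 - fgen X2 \<and> s 0 = 1 \<and> s 1 = 1 \<and> s 2 = Psi2 \<and>
     (\<forall>m. s (m + 2) * s (m - 2) = beta1\<^sup>2 * s (m + 1) * s (m - 1) - beta2 * (s m)\<^sup>2)"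

(* Well-defined by the lemma is_Psi_unique below. *)
definition Psi :: "int \<Rightarrow> rstar fract" where
  "Psi = (THE s. is_Psi s)"

definition Phi :: "int \<Rightarrow> rstar fract" where
  "Phi n = fgen X1 * (Psi n)\<^sup>2 - Psi (n + 1) * Psi (n - 1)"

definition Omega :: "int \<Rightarrow> rstar fract" where
  "Omega n = ((Psi (n - 1))\<^sup>2 * Psi (n + 2) - Psi (n - 2) * (Psi (n + 1))\<^sup>2
      - beta1 * Psi n * (fgen Alpha1 * Phi n + fgen Alpha3 * (Psi n)\<^sup>2)) / (2 * beta1)"

definition is_specialization ::
  "'a::field weierstrass \<Rightarrow> 'a point \<Rightarrow> 'a point \<Rightarrow> (rstar \<Rightarrow> 'a) \<Rightarrow> bool" where
  "is_specialization E P1 P2 h \<longleftrightarrow> ring_homomorphism h \<and>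
     h (gen Alpha1) = a1 E \<and> h (gen Alpha2) = a2 E \<and> h (gen Alpha3) = a3 E \<and>
     h (gen Alpha4) = a4 E \<and> h (gen Alpha6) = a6 E \<and>
     h (gen X1) = xcoord P1 \<and> h (gen Y1) = ycoord P1 \<and>
     h (gen X2) = xcoord P2 \<and> h (gen Y2) = ycoord P2"

(* Well-defined for affine points with P2 \<noteq> P1, - P1 by the lemma is_specialization_unique below. *)
definition specialization ::
  "'a::field weierstrass \<Rightarrow> 'a point \<Rightarrow> 'a point \<Rightarrow> rstar \<Rightarrow> 'a" where
  "specialization E P1 P2 = (THE h. is_specialization E P1 P2 h)"

(* The value at (P1, P2) of an element z of the fraction field of R*. It is meaningful only
   if z lies in R* (as all Psi n, Phi n, Omega n do; that is not proved here); the element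
   of R* is unique by of_rstar_eq_iff. *)
definition value_at ::
  "'a::field weierstrass \<Rightarrow> 'a point \<Rightarrow> 'a point \<Rightarrow> rstar fract \<Rightarrow> 'a" where
  "value_at E P1 P2 z = specialization E P1 P2 (THE r. of_rstar r = z)"

definition purely_periodic :: "(nat \<Rightarrow> 'a) \<Rightarrow> nat \<Rightarrow> bool" where
  "purely_periodic s p \<longleftrightarrow> p \<ge> 1 \<and> (\<forall>n. s (n + p) = s n)"


section \<open>Well-definedness\<close>

lemma of_rstar_eq_iff: "of_rstar r = of_rstar s \<longleftrightarrow> r = s"
  by (simp add: of_rstar_def eq_fract)

lemma the_of_rstar: "(THE r. of_rstar r = of_rstar s) = s"
  by (simp add: of_rstar_eq_iff)

lemma ring_homomorphism_of_rstar: "ring_homomorphism of_rstar"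
  by (simp add: ring_homomorphism_def of_rstar_def One_fract_def)

lemma ring_homomorphism_abs_rstar: "ring_homomorphism abs_rstar"
  unfolding ring_homomorphism_def
  by (simp add: one_rstar.abs_eq plus_rstar.abs_eq times_rstar.abs_eq)

definition rstar_eval :: "(var \<Rightarrow> 'a::comm_ring_1) \<Rightarrow> rstar \<Rightarrow> 'a" where
  "rstar_eval a r = poly_eval a (rep_rstar r)"

lemma rstar_eval_abs:
  assumes "admissible a"
  shows "rstar_eval a (abs_rstar p) = poly_eval a p"
proof -
  have "rstar_rel (rep_rstar (abs_rstar p)) p"
    by (simp add: Quotient3_rstar rep_abs_rsp_left rstar.abs_eq_iff[symmetric]
        Quotient3_abs_rep[OF Quotient3_rstar])
  hence "poly_eval a (rep_rstar (abs_rstar p) - p) = 0"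
    unfolding rstar_rel_def by (rule poly_eval_ideal[OF assms])
  thus ?thesis by (simp add: rstar_eval_def poly_eval_simps)
qed

lemma rstar_eval_gen: "admissible a \<Longrightarrow> rstar_eval a (gen v) = a v"
  by (simp add: gen_def rstar_eval_abs poly_eval_Var)

lemma ring_homomorphism_rstar_eval:
  assumes "admissible a"
  shows "ring_homomorphism (rstar_eval a)"
  unfolding ring_homomorphism_def
proof (intro conjI allI)
  have "rstar_eval a (abs_rstar 1) = 1"
    by (simp only: rstar_eval_abs[OF assms] poly_eval_1)
  thus "rstar_eval a 1 = 1" by (simp add: one_rstar.abs_eq)
  fix x y
  obtain p q where pq: "x = abs_rstar p" "y = abs_rstar q"
    by (metis Quotient3_abs_rep[OF Quotient3_rstar])
  show "rstar_eval a (x + y) = rstar_eval a x + rstar_eval a y"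
    by (simp add: pq plus_rstar.abs_eq rstar_eval_abs[OF assms] poly_eval_add)
  show "rstar_eval a (x * y) = rstar_eval a x * rstar_eval a y"
    by (simp add: pq times_rstar.abs_eq rstar_eval_abs[OF assms] poly_eval_mult)
qed

lemma ring_homomorphism_rstar_ext:
  assumes h: "ring_homomorphism h" and h': "ring_homomorphism h'"
    and eq: "\<And>v. h (gen v) = h' (gen v)"
  shows "h = h'"
proof
  fix r
  obtain p where p: "r = abs_rstar p" by (metis Quotient3_abs_rep[OF Quotient3_rstar])
  have "ring_homomorphism (\<lambda>p. h (abs_rstar p))" "ring_homomorphism (\<lambda>p. h' (abs_rstar p))"
    using h h' ring_homomorphism_abs_rstar by (simp_all add: ring_homomorphism_def)
  from this[THEN ring_homomorphism_eq_poly_eval, of p] show "h r = h' r"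
    using eq by (simp add: p gen_def)
qed

lemma gen_Inv12: "gen Inv12 * (gen X1 - gen X2) = 1"
proof -
  have "in_ideal (Var Inv12 * (Var X1 - Var X2) - 1)"
    unfolding in_ideal_def by (rule exI[of _ 0], rule exI[of _ 0], rule exI[of _ 1], simp)
  hence "abs_rstar (Var Inv12 * (Var X1 - Var X2)) = abs_rstar 1"
    by (simp add: rstar.abs_eq_iff rstar_rel_def)
  thus ?thesis
    by (simp add: gen_def ring_homomorphismD[OF ring_homomorphism_abs_rstar])
qed

lemma xcoord_neq:
  assumes "P1 \<in> points E" "P2 \<in> points E" "P1 \<noteq> Infinity" "P2 \<noteq> Infinity"
    "ec_add E P2 P1 \<noteq> Infinity" "ec_add E P2 (ec_neg E P1) \<noteq> Infinity"
  shows "xcoord P1 \<noteq> xcoord P2"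
proof
  assume eq: "xcoord P1 = xcoord P2"
  obtain x y z where P: "P1 = Affine x y" "P2 = Affine x z"
    "weierstrass_poly E x y = 0" "weierstrass_poly E x z = 0"
    using assms(1-4) eq by (auto simp: points_def)
  have "z + y + a1 E * x + a3 E \<noteq> 0" using assms(5) P by (auto simp: Let_def)
  moreover have "z - y \<noteq> 0" using assms(6) P by (auto simp: Let_def)
  moreover have "(z - y) * (z + y + a1 E * x + a3 E) =
      weierstrass_poly E x z - weierstrass_poly E x y"
    by (simp add: weierstrass_poly_def algebra_simps power2_eq_square)
  ultimately show False using P(3,4) by simp
qed

lemma is_specialization_unique:
  assumes "P1 \<in> points E" "P2 \<in> points E" "P1 \<noteq> Infinity" "P2 \<noteq> Infinity"
    "ec_add E P2 P1 \<noteq> Infinity" "ec_add E P2 (ec_neg E P1) \<noteq> Infinity"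
  shows "\<exists>!h. is_specialization E P1 P2 h"
proof -
  let ?d = "xcoord P1 - xcoord P2"
  have d: "?d \<noteq> 0" using xcoord_neq[OF assms] by simp
  define a where "a v = (case v of Alpha1 \<Rightarrow> a1 E | Alpha2 \<Rightarrow> a2 E | Alpha3 \<Rightarrow> a3 E
    | Alpha4 \<Rightarrow> a4 E | Alpha6 \<Rightarrow> a6 E | X1 \<Rightarrow> xcoord P1 | Y1 \<Rightarrow> ycoord P1
    | X2 \<Rightarrow> xcoord P2 | Y2 \<Rightarrow> ycoord P2 | Inv12 \<Rightarrow> 1 / ?d)" for v
  have "curve_of a = E" by (simp add: curve_of_def a_def)
  hence adm: "admissible a"
    using assms(1-4) d by (auto simp: admissible_def a_def points_def)
  have uniq: "h = rstar_eval a" if h: "is_specialization E P1 P2 h" for h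
  proof (rule ring_homomorphism_rstar_ext)
    show hom: "ring_homomorphism h" using h by (simp add: is_specialization_def)
    show "ring_homomorphism (rstar_eval a)" by (rule ring_homomorphism_rstar_eval[OF adm])
    have "h (gen Inv12) * ?d = h (gen Inv12 * (gen X1 - gen X2))"
      using h by (simp add: ring_homomorphismD[OF hom] is_specialization_def)
    hence "h (gen Inv12) = 1 / ?d"
      using d by (simp add: gen_Inv12 ring_homomorphismD[OF hom] field_simps)
    thus "h (gen v) = rstar_eval a (gen v)" for v
      using h unfolding rstar_eval_gen[OF adm] is_specialization_def a_def
      by (cases v) auto
  qed
  have "is_specialization E P1 P2 (rstar_eval a)"
    by (simp add: is_specialization_def ring_homomorphism_rstar_eval adm rstar_eval_gen)
       (simp add: a_def)
  with uniq show ?thesis by blast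
qed

text \<open>Existence and uniqueness of the \<open>\<Psi>\<^sub>n\<close> amounts to none of them being zero. This
  is shown by specialising to the curve \<open>y\<^sup>2 = x\<^sup>3\<close> over the rationals with the points
  \<open>(1, 1)\<close> and \<open>(4, 8)\<close>, where \<open>\<Psi>\<^sub>n\<close> becomes \<open>(2 n + 1) / 3\<^sup>n\<close>.\<close>

definition cusp :: "var \<Rightarrow> rat" where
  "cusp v = (case v of X1 \<Rightarrow> 1 | Y1 \<Rightarrow> 1 | X2 \<Rightarrow> 4 | Y2 \<Rightarrow> 8 | Inv12 \<Rightarrow> - 1 / 3 | _ \<Rightarrow> 0)"

lemma admissible_cusp: "admissible cusp"
  by (simp add: admissible_def cusp_def curve_of_def weierstrass_poly_def)

lemmas cusp_eval_simps = ring_homomorphismD[OF ring_homomorphism_rstar_eval[OF admissible_cusp]]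

definition cusp_val :: "rstar fract \<Rightarrow> rat \<Rightarrow> bool" where
  "cusp_val z w \<longleftrightarrow> (\<exists>p s. z = Fract p s \<and> rstar_eval cusp s \<noteq> 0 \<and>
     rstar_eval cusp p = w * rstar_eval cusp s)"

lemma cusp_valI:
  "rstar_eval cusp s \<noteq> 0 \<Longrightarrow> rstar_eval cusp p = w * rstar_eval cusp s \<Longrightarrow> cusp_val (Fract p s) w"
  unfolding cusp_val_def by blast

lemma cusp_eval_nonzero: "rstar_eval cusp s \<noteq> 0 \<Longrightarrow> s \<noteq> 0"
  using cusp_eval_simps(1) by metis

lemma cusp_val_nonzero: "cusp_val z w \<Longrightarrow> w \<noteq> 0 \<Longrightarrow> z \<noteq> 0"
  unfolding cusp_val_def using cusp_eval_nonzero
  by (auto simp: Zero_fract_def eq_fract cusp_eval_simps)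

lemma cusp_val_fgen: "cusp_val (fgen v) (cusp v)"
  unfolding fgen_def of_rstar_def
  by (rule cusp_valI) (simp_all add: cusp_eval_simps rstar_eval_gen[OF admissible_cusp])

lemma cusp_val_add: "cusp_val z w \<Longrightarrow> cusp_val z' w' \<Longrightarrow> cusp_val (z + z') (w + w')"
  unfolding cusp_val_def[of z] cusp_val_def[of z']
  by (auto simp: cusp_eval_nonzero cusp_eval_simps algebra_simps intro!: cusp_valI)

lemma cusp_val_mult: "cusp_val z w \<Longrightarrow> cusp_val z' w' \<Longrightarrow> cusp_val (z * z') (w * w')"
  unfolding cusp_val_def[of z] cusp_val_def[of z']
  by (auto simp: cusp_eval_nonzero cusp_eval_simps algebra_simps intro!: cusp_valI)

lemma cusp_val_diff: "cusp_val z w \<Longrightarrow> cusp_val z' w' \<Longrightarrow> cusp_val (z - z') (w - w')"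
  unfolding cusp_val_def[of z] cusp_val_def[of z']
  by (auto simp: cusp_eval_nonzero cusp_eval_simps algebra_simps intro!: cusp_valI)

lemma cusp_val_divide:
  "cusp_val z w \<Longrightarrow> cusp_val z' w' \<Longrightarrow> w' \<noteq> 0 \<Longrightarrow> cusp_val (z / z') (w / w')"
  unfolding cusp_val_def[of z] cusp_val_def[of z']
  by (auto simp: cusp_eval_nonzero cusp_eval_simps field_simps intro!: cusp_valI)

lemma cusp_val_1: "cusp_val 1 1"
  unfolding One_fract_def by (rule cusp_valI) (simp_all add: cusp_eval_simps)

lemma cusp_val_0: "cusp_val 0 0"
  unfolding Zero_fract_def by (rule cusp_valI) (simp_all add: cusp_eval_simps)

lemma cusp_val_numeral: "cusp_val (numeral k) (numeral k)"
proof -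
  have "cusp_val (of_nat n) (of_nat n)" for n
    by (induction n) (auto intro: cusp_val_0 cusp_val_1 cusp_val_add)
  from this[of "numeral k"] show ?thesis by simp
qed

lemma cusp_val_power: "cusp_val z w \<Longrightarrow> cusp_val (z ^ n) (w ^ n)"
  by (induction n) (auto intro: cusp_val_1 cusp_val_mult)

lemmas cusp_val_intros = cusp_val_numeral cusp_val_add cusp_val_diff cusp_val_mult cusp_val_power
  cusp_val_fgen cusp_val_1 cusp_val_0

lemma cusp_val_cong: "cusp_val z w \<Longrightarrow> w = w' \<Longrightarrow> cusp_val z w'"
  by simp

lemma cusp_val_beta1: "cusp_val beta1 2"
proof -
  have "cusp_val beta1 (2 * cusp Y1 + cusp Alpha1 * cusp X1 + cusp Alpha3)"
    unfolding beta1_def by (intro cusp_val_intros)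
  thus ?thesis by (simp add: cusp_def)
qed

lemma cusp_val_beta2: "cusp_val beta2 3"
proof (rule cusp_val_cong)
  show "cusp_val beta2 (let E = curve_of cusp; x = cusp X1 in
     3 * x ^ 4 + b2 E * x ^ 3 + 3 * b4 E * x\<^sup>2 + 3 * b6 E * x + b8 E)"
    unfolding beta2_def Let_def b2_def b4_def b6_def b8_def curve_of_def weierstrass.simps
    by (intro cusp_val_intros)
qed (simp add: Let_def b2_def b4_def b6_def b8_def curve_of_def cusp_def)

lemma cusp_val_Psi2: "cusp_val Psi2 (5 / 9)"
proof (rule cusp_val_cong)
  show "cusp_val Psi2 (let l = (cusp Y2 - cusp Y1) / (cusp X2 - cusp X1) in
     2 * cusp X1 + cusp X2 - l\<^sup>2 - cusp Alpha1 * l + cusp Alpha2)"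
    unfolding Psi2_def Let_def
    by (intro cusp_val_intros cusp_val_divide) (simp_all add: cusp_def)
qed (simp add: Let_def cusp_def power2_eq_square)

lemma cusp_val_Psim1: "cusp_val (fgen X1 - fgen X2) (- 3)"
proof (rule cusp_val_cong)
  show "cusp_val (fgen X1 - fgen X2) (cusp X1 - cusp X2)" by (intro cusp_val_intros)
qed (simp add: cusp_def)

fun somos :: "'a::field \<Rightarrow> 'a \<Rightarrow> 'a \<Rightarrow> 'a \<Rightarrow> nat \<Rightarrow> 'a" where
  "somos s t A B 0 = s"
| "somos s t A B (Suc 0) = 1"
| "somos s t A B (Suc (Suc 0)) = 1"
| "somos s t A B (Suc (Suc (Suc 0))) = t"
| "somos s t A B (Suc (Suc (Suc (Suc n)))) =
     (A * somos s t A B (Suc (Suc (Suc n))) * somos s t A B (Suc n)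
       - B * (somos s t A B (Suc (Suc n)))\<^sup>2) / somos s t A B n"

abbreviation Psi_up :: "nat \<Rightarrow> rstar fract" where
  "Psi_up \<equiv> somos (fgen X1 - fgen X2) Psi2 (beta1\<^sup>2) beta2"

abbreviation Psi_down :: "nat \<Rightarrow> rstar fract" where
  "Psi_down \<equiv> somos Psi2 (fgen X1 - fgen X2) (beta1\<^sup>2) beta2"

lemma cusp_val_Psi_up: "cusp_val (Psi_up n) ((2 * of_nat n - 1) * 3 / 3 ^ n)"
proof (induction n rule: less_induct)
  case (less n)
  consider "n = 0" | "n = 1" | "n = 2" | "n = 3" | k where "n = Suc (Suc (Suc (Suc k)))"
    by (metis One_nat_def Suc_1 not0_implies_Suc numeral_3_eq_3)
  thus ?case
  proof cases
    case 5
    let ?w = "\<lambda>n. (2 * of_nat n - 1) * 3 / 3 ^ n :: rat"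
    have "(of_nat (2 * k) :: rat) \<noteq> of_nat 1"
      unfolding of_nat_eq_iff by presburger
    hence nz: "?w k \<noteq> 0" by simp
    have "cusp_val (Psi_up n)
       ((2\<^sup>2 * ?w (Suc (Suc (Suc k))) * ?w (Suc k) - 3 * (?w (Suc (Suc k)))\<^sup>2) / ?w k)"
      unfolding 5 somos.simps
      by (intro cusp_val_divide cusp_val_diff cusp_val_mult cusp_val_power
            cusp_val_beta1 cusp_val_beta2 less.IH nz) (simp_all add: 5)
    moreover have "(2\<^sup>2 * ?w (Suc (Suc (Suc k))) * ?w (Suc k) - 3 * (?w (Suc (Suc k)))\<^sup>2) / ?w k = ?w n"
      using nz unfolding 5 by (simp add: field_simps power2_eq_square)
    ultimately show ?thesis by (rule cusp_val_cong)
  qed (use cusp_val_Psim1 cusp_val_1 cusp_val_Psi2 in \<open>auto simp: numeral_2_eq_2 numeral_3_eq_3\<close>)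
qed


lemma cusp_val_Psi_down: "cusp_val (Psi_down n) ((5 - 2 * of_nat n) * 3 ^ n / 9)"
proof (induction n rule: less_induct)
  case (less n)
  consider "n = 0" | "n = 1" | "n = 2" | "n = 3" | k where "n = Suc (Suc (Suc (Suc k)))"
    by (metis One_nat_def Suc_1 not0_implies_Suc numeral_3_eq_3)
  thus ?case
  proof cases
    case 5
    let ?w = "\<lambda>n. (5 - 2 * of_nat n) * 3 ^ n / 9 :: rat"
    have "(of_nat (2 * k) :: rat) \<noteq> of_nat 5"
      unfolding of_nat_eq_iff by presburger
    hence nz: "?w k \<noteq> 0" by simp
    have "cusp_val (Psi_down n)
       ((2\<^sup>2 * ?w (Suc (Suc (Suc k))) * ?w (Suc k) - 3 * (?w (Suc (Suc k)))\<^sup>2) / ?w k)"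
      unfolding 5 somos.simps
      by (intro cusp_val_divide cusp_val_diff cusp_val_mult cusp_val_power
            cusp_val_beta1 cusp_val_beta2 less.IH nz) (simp_all add: 5)
    moreover have "(2\<^sup>2 * ?w (Suc (Suc (Suc k))) * ?w (Suc k) - 3 * (?w (Suc (Suc k)))\<^sup>2) / ?w k = ?w n"
      using nz unfolding 5 by (simp add: field_simps power2_eq_square)
    ultimately show ?thesis by (rule cusp_val_cong)
  qed (use cusp_val_Psim1 cusp_val_1 cusp_val_Psi2 in \<open>auto simp: numeral_2_eq_2 numeral_3_eq_3\<close>)
qed

lemma Psi_up_nonzero: "Psi_up n \<noteq> 0"
proof (rule cusp_val_nonzero[OF cusp_val_Psi_up])
  have "(of_nat (2 * n) :: rat) \<noteq> of_nat 1"
    unfolding of_nat_eq_iff by presburger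
  thus "(2 * of_nat n - 1) * 3 / 3 ^ n \<noteq> (0::rat)" by simp
qed

lemma Psi_down_nonzero: "Psi_down n \<noteq> 0"
proof (rule cusp_val_nonzero[OF cusp_val_Psi_down])
  have "(of_nat (2 * n) :: rat) \<noteq> of_nat 5"
    unfolding of_nat_eq_iff by presburger
  thus "(5 - 2 * of_nat n) * 3 ^ n / 9 \<noteq> (0::rat)" by simp
qed

lemma somos_unique:
  assumes "f 0 = s" "f 1 = 1" "f 2 = 1" "f 3 = t"
    and rec: "\<And>n. f (n + 4) * f n = A * f (n + 3) * f (n + 1) - B * (f (n + 2))\<^sup>2"
    and nz: "\<And>n. somos s t A B n \<noteq> 0"
  shows "f n = somos s t A B n"
proof (induction n rule: less_induct)
  case (less n)
  consider "n = 0" | "n = 1" | "n = 2" | "n = 3" | k where "n = Suc (Suc (Suc (Suc k)))"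
    by (metis One_nat_def Suc_1 not0_implies_Suc numeral_3_eq_3)
  thus ?case
  proof cases
    case 5
    have "f n * f k = A * f (Suc (Suc (Suc k))) * f (Suc k) - B * (f (Suc (Suc k)))\<^sup>2"
      using rec[of k] by (simp add: 5 numeral_2_eq_2 numeral_3_eq_3 eval_nat_numeral)
    hence "f n * somos s t A B k = A * somos s t A B (Suc (Suc (Suc k))) * somos s t A B (Suc k)
             - B * (somos s t A B (Suc (Suc k)))\<^sup>2"
      using less.IH by (simp add: 5)
    thus ?thesis using nz[of k] by (simp add: 5 field_simps)
  qed (use assms(1-4) in \<open>auto simp: numeral_2_eq_2 numeral_3_eq_3\<close>)
qed

lemma is_Psi_up: "is_Psi s \<Longrightarrow> s (int n - 1) = Psi_up n"
proof (rule somos_unique[where f = "\<lambda>n. s (int n - 1)"])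
  assume s: "is_Psi s"
  show "s (int (n + 4) - 1) * s (int n - 1) = beta1\<^sup>2 * s (int (n + 3) - 1) * s (int (n + 1) - 1)
          - beta2 * (s (int (n + 2) - 1))\<^sup>2" for n
  proof -
    have "s ((int n + 1) + 2) * s ((int n + 1) - 2) = beta1\<^sup>2 * s ((int n + 1) + 1) * s ((int n + 1) - 1)
            - beta2 * (s (int n + 1))\<^sup>2"
      using s unfolding is_Psi_def by blast
    thus ?thesis by (simp add: algebra_simps)
  qed
qed (auto simp: is_Psi_def Psi_up_nonzero)

lemma is_Psi_down: "is_Psi s \<Longrightarrow> s (2 - int n) = Psi_down n"
proof (rule somos_unique[where f = "\<lambda>n. s (2 - int n)"])
  assume s: "is_Psi s"
  show "s (2 - int (n + 4)) * s (2 - int n) = beta1\<^sup>2 * s (2 - int (n + 3)) * s (2 - int (n + 1))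
          - beta2 * (s (2 - int (n + 2)))\<^sup>2" for n
  proof -
    have "s (- int n + 2) * s (- int n - 2) = beta1\<^sup>2 * s (- int n + 1) * s (- int n - 1)
            - beta2 * (s (- int n))\<^sup>2"
      using s unfolding is_Psi_def by blast
    moreover have "2 - int (n + 4) = - int n - 2" "2 - int n = - int n + 2"
        "2 - int (n + 3) = - int n - 1" "2 - int (n + 1) = - int n + 1" "2 - int (n + 2) = - int n"
      by simp_all
    ultimately show ?thesis by (simp only:) (simp only: mult_ac)
  qed
qed (auto simp: is_Psi_def Psi_down_nonzero)

lemma is_Psi_unique: "\<exists>!s. is_Psi s"
proof -
  define s where "s n = (if n \<ge> 0 then Psi_up (nat (n + 1)) else Psi_down (nat (2 - n)))" for n
  have up: "s (int n - 1) = Psi_up n" for n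
    by (cases n) (auto simp: s_def nat_add_distrib eval_nat_numeral)
  have down: "s (2 - int n) = Psi_down n" for n
  proof -
    consider "n = 0" | "n = 1" | "n = 2" | "n = 3" | "n > 3" by linarith
    thus ?thesis by cases (auto simp: s_def eval_nat_numeral)
  qed
  have "is_Psi s"
    unfolding is_Psi_def
  proof (intro conjI allI)
    show "s (-1) = fgen X1 - fgen X2" "s 0 = 1" "s 1 = 1" "s 2 = Psi2"
      using up[of 0] up[of 1] up[of 2] up[of 3] by (simp_all add: eval_nat_numeral)
    fix m :: int
    show "s (m + 2) * s (m - 2) = beta1\<^sup>2 * s (m + 1) * s (m - 1) - beta2 * (s m)\<^sup>2"
    proof (cases "m \<ge> 1")
      case True
      then obtain n where n: "m = int n + 1" by (metis add.commute zle_iff_zadd)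
      have "s (m + 2) = Psi_up (Suc (Suc (Suc (Suc n))))" "s (m + 1) = Psi_up (Suc (Suc (Suc n)))"
        "s m = Psi_up (Suc (Suc n))" "s (m - 1) = Psi_up (Suc n)" "s (m - 2) = Psi_up n"
        using up[of n] up[of "Suc n"] up[of "Suc (Suc n)"] up[of "Suc (Suc (Suc n))"]
          up[of "Suc (Suc (Suc (Suc n)))"]
        by (simp_all add: n algebra_simps del: somos.simps)
      thus ?thesis using Psi_up_nonzero[of n] by simp
    next
      case False
      then obtain n where n: "m = - int n"
        using nonneg_int_cases[of "- m"] by (metis minus_minus neg_0_le_iff_le not_le zle_diff1_eq diff_self)
      have "s (m - 2) = Psi_down (Suc (Suc (Suc (Suc n))))" "s (m - 1) = Psi_down (Suc (Suc (Suc n)))"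
        "s m = Psi_down (Suc (Suc n))" "s (m + 1) = Psi_down (Suc n)" "s (m + 2) = Psi_down n"
        using arg_cong[OF minus_diff_commute[of "int n" 1], of s] down[of n] down[of "Suc n"] down[of "Suc (Suc n)"] down[of "Suc (Suc (Suc n))"]
          down[of "Suc (Suc (Suc (Suc n)))"]
        by (simp_all add: n algebra_simps del: somos.simps)
      thus ?thesis using Psi_down_nonzero[of n] by (simp add: mult.commute mult.left_commute)
    qed
  qed
  moreover have "s1 = s2" if "is_Psi s1" "is_Psi s2" for s1 s2
  proof
    fix n :: int
    show "s1 n = s2 n"
    proof (cases "n \<ge> 0")
      case True
      thus ?thesis
        using is_Psi_up[OF that(1), of "nat (n + 1)"] is_Psi_up[OF that(2), of "nat (n + 1)"] by simp
    next
      case False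
      thus ?thesis
        using is_Psi_down[OF that(1), of "nat (2 - n)"] is_Psi_down[OF that(2), of "nat (2 - n)"] by simp
    qed
  qed
  ultimately show ?thesis by blast
qed

lemma is_Psi_Psi: "is_Psi Psi"
  unfolding Psi_def by (rule theI'[OF is_Psi_unique])

end

(* Both the translated division polynomials Psi and the ordinary division polynomials psi of P1
   satisfy the same Somos-4 recurrence with the same conserved quantity. This gives, by induction
   on m, the addition formula
     Psi(n+m) Psi(n-m) = psi(m)^2 Psi(n+1) Psi(n-1) - psi(m+1) psi(m-1) Psi(n)^2.
   Its cases m = n and m = n - 1 have the left hand sides Psi(2n) and Psi(2n-1), whence integrality.
   For Omega, beta1 Omega(n) is an explicit polynomial that is seen to be divisible by beta1 from
   closed forms of psi and Psi modulo beta1; no division by 2 occurs, so characteristic 2 needs no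
   special treatment.

   Over a finite field, the recurrence shows that psi vanishes at some m > 0, and the least such m
   is the order r of P1: the chord construction reproduces the division polynomial formulas
   for [n]P1 step by step, so associativity of the group law is never used. With psi(r) = 0 the
   addition formula for m = r, r + 1 and the recurrence yield Psi(n+r) = c b^n Psi(n), where b^r is
   a square. In Psi(n + r(q-1)) the exponent of b^r is (q-1)(q-2)/2, and as b^r = s^2 this
   contributes s^((q-1)(q-2)) = 1. So t = t' = t'' = q - 1 works. *)

theory Submission
  imports Defs
begin

section \<open>Somos-4 sequences and the addition formula\<close>

text \<open>A Somos-4 recurrence together with its conserved quantity \<open>J\<close>, cleared of denominators.\<close>

definition elliptic_seq :: "'a::comm_ring_1 \<Rightarrow> 'a \<Rightarrow> 'a \<Rightarrow> (int \<Rightarrow> 'a) \<Rightarrow> bool" where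
  "elliptic_seq \<alpha> \<beta> J A \<longleftrightarrow>
     (\<forall>n. A (n + 2) * A (n - 2) = \<alpha> * A (n + 1) * A (n - 1) - \<beta> * (A n)\<^sup>2) \<and>
     (\<forall>n. A (n + 2) * (A (n - 1))\<^sup>2 + A (n - 2) * (A (n + 1))\<^sup>2 =
        J * A (n + 1) * A n * A (n - 1) - \<alpha> * A n ^ 3)"

lemma elliptic_seqD:
  assumes "elliptic_seq \<alpha> \<beta> J A"
  shows "A (n + 2) * A (n - 2) = \<alpha> * A (n + 1) * A (n - 1) - \<beta> * (A n)\<^sup>2"
    and "A (n + 2) * (A (n - 1))\<^sup>2 + A (n - 2) * (A (n + 1))\<^sup>2 =
           J * A (n + 1) * A n * A (n - 1) - \<alpha> * A n ^ 3"
  using assms unfolding elliptic_seq_def by blast+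

text \<open>Here \<open>u, x, w, z, y, v\<close> are consecutive terms. After multiplication by
  \<open>x\<close>, the two recurrences reduce the new identity to \<open>y\<close> times the old
  one.\<close>

lemma somos_invariant_step:
  fixes v w x y z u :: "'a::idom"
  assumes "y * u = \<alpha> * z * x - \<beta> * w\<^sup>2" "v * x = \<alpha> * y * w - \<beta> * z\<^sup>2"
    and "y * x\<^sup>2 + u * z\<^sup>2 = J * z * w * x - \<alpha> * w ^ 3" and "x \<noteq> 0"
  shows "v * w\<^sup>2 + x * y\<^sup>2 = J * y * z * w - \<alpha> * z ^ 3"
proof -
  have "x * (v * w\<^sup>2 + x * y\<^sup>2) = x * (J * y * z * w - \<alpha> * z ^ 3)"
    using assms(1-3) by algebra
  thus ?thesis using \<open>x \<noteq> 0\<close> by simp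
qed

lemma elliptic_seqI:
  fixes A :: "int \<Rightarrow> 'a::idom"
  assumes rec: "\<And>n. A (n + 2) * A (n - 2) = \<alpha> * A (n + 1) * A (n - 1) - \<beta> * (A n)\<^sup>2"
    and init: "A 2 * (A (-1))\<^sup>2 + A (-2) * (A 1)\<^sup>2 = J * A 1 * A 0 * A (-1) - \<alpha> * A 0 ^ 3"
    and nz: "\<And>n. A n \<noteq> 0"
  shows "elliptic_seq \<alpha> \<beta> J A"
  unfolding elliptic_seq_def
proof (intro conjI allI)
  fix n :: int
  show "A (n + 2) * (A (n - 1))\<^sup>2 + A (n - 2) * (A (n + 1))\<^sup>2 =
      J * A (n + 1) * A n * A (n - 1) - \<alpha> * A n ^ 3" (is "?T n")
  proof (induction n rule: int_induct[where k = 0])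
    case base
    show ?case using init by simp
  next
    case (step1 i)
    have "A (i + 3) * A (i - 1) = \<alpha> * A (i + 2) * A i - \<beta> * (A (i + 1))\<^sup>2"
      using rec[of "i + 1"] by (simp add: algebra_simps)
    from somos_invariant_step[OF rec this step1(2) nz] show ?case
      by (simp add: algebra_simps)
  next
    \<comment> \<open>Recurrence and invariant are symmetric under reversing the terms, so the
      downward step is the same lemma for the reversed window.\<close>
    case (step2 i)
    have 1: "A (i - 2) * A (i + 2) = \<alpha> * A (i - 1) * A (i + 1) - \<beta> * (A i)\<^sup>2"
      using rec[of i] by (simp add: algebra_simps)
    have 2: "A (i - 3) * A (i + 1) = \<alpha> * A (i - 2) * A i - \<beta> * (A (i - 1))\<^sup>2"
      using rec[of "i - 1"] by (simp add: algebra_simps)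
    have 3: "A (i - 2) * (A (i + 1))\<^sup>2 + A (i + 2) * (A (i - 1))\<^sup>2 =
        J * A (i - 1) * A i * A (i + 1) - \<alpha> * A i ^ 3"
      using step2(2) by (simp add: algebra_simps)
    from somos_invariant_step[OF 1 2 3 nz] show ?case
      by (simp add: algebra_simps)
  qed
qed (rule rec)

text \<open>Induction in steps of two: the cases \<open>m - 1\<close> at \<open>n + 1\<close> and
  \<open>n - 1\<close> multiply to the wanted product times the left-hand side of the case
  \<open>m - 2\<close> at \<open>n\<close>, which is then cancelled. Nonvanishing is asked only near
  \<open>n\<close>, since the division polynomials themselves vanish at 0.\<close>

lemma elliptic_seq_addition_nat:
  fixes A p :: "int \<Rightarrow> 'a::idom"
  assumes A: "elliptic_seq \<alpha> \<beta> J A" and p: "elliptic_seq \<alpha> \<beta> J p"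
    and p0: "p (-1) = -1" "p 0 = 0" "p 1 = 1"
    and nz: "\<And>k. \<bar>k - n\<bar> \<le> int m \<Longrightarrow> A k \<noteq> 0"
  shows "A (n + int m) * A (n - int m) =
     (p (int m))\<^sup>2 * A (n + 1) * A (n - 1) - p (int m + 1) * p (int m - 1) * (A n)\<^sup>2"
  using nz
proof (induction m arbitrary: n rule: less_induct)
  case (less m)
  consider "m = 0" | "m = 1" | k where "m = Suc (Suc k)"
    by (metis One_nat_def not0_implies_Suc)
  thus ?case
  proof cases
    case 3
    define i where "i = int k + 1"
    have mi: "int m = i + 1" "i \<ge> 1" by (simp_all add: 3 i_def)
    let ?a = "A (n + i - 1) * A (n - i + 1)"
    let ?b = "A (n + i + 1) * A (n - i - 1)"
    have I0: "?a = (p (i - 1))\<^sup>2 * A (n + 1) * A (n - 1) - p i * p (i - 2) * (A n)\<^sup>2"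
      using less.IH[of k n] less.prems by (simp add: 3 i_def algebra_simps)
    have I1: "A (n + i + 1) * A (n - i + 1) = (p i)\<^sup>2 * A (n + 2) * A n - p (i + 1) * p (i - 1) * (A (n + 1))\<^sup>2"
      using less.IH[of "Suc k" "n + 1"] less.prems by (simp add: 3 i_def algebra_simps)
    have I2: "A (n + i - 1) * A (n - i - 1) = (p i)\<^sup>2 * A n * A (n - 2) - p (i + 1) * p (i - 1) * (A (n - 1))\<^sup>2"
      using less.IH[of "Suc k" "n - 1"] less.prems by (simp add: 3 i_def algebra_simps)
    let ?c = "(p (i + 1))\<^sup>2 * A (n + 1) * A (n - 1) - p (i + 2) * p i * (A n)\<^sup>2"
    have "?a * ?b = ((p i)\<^sup>2 * A (n + 2) * A n - p (i + 1) * p (i - 1) * (A (n + 1))\<^sup>2)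
       * ((p i)\<^sup>2 * A n * A (n - 2) - p (i + 1) * p (i - 1) * (A (n - 1))\<^sup>2)"
      unfolding I1[symmetric] I2[symmetric] by (simp only: mult_ac)
    \<comment> \<open>The mixed terms of both sides contain the left-hand sides of the two conserved
      quantities; they match because \<open>J\<close> is the same for \<open>A\<close> and
      \<open>p\<close>.\<close>
    also have "\<dots> = ((p (i - 1))\<^sup>2 * A (n + 1) * A (n - 1) - p i * p (i - 2) * (A n)\<^sup>2) * ?c"
      using elliptic_seqD[OF A, of n] elliptic_seqD[OF p, of i] by algebra
    also have "\<dots> = ?a * ?c" unfolding I0 ..
    finally have "?b = ?c"
      using less.prems[of "n + i - 1"] less.prems[of "n - i + 1"] mi by simp
    thus ?thesis by (simp add: mi algebra_simps)
  qed (use p0 in \<open>simp_all add: power2_eq_square\<close>)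
qed

lemma elliptic_seq_addition:
  fixes A p :: "int \<Rightarrow> 'a::idom"
  assumes "elliptic_seq \<alpha> \<beta> J A" and "elliptic_seq \<alpha> \<beta> J p"
    and p: "\<And>k. p (- k) = - p k" "p 1 = 1" "p 0 = 0"
    and nz: "\<And>k. \<bar>k - n\<bar> \<le> \<bar>m\<bar> \<Longrightarrow> A k \<noteq> 0"
  shows "A (n + m) * A (n - m) =
     (p m)\<^sup>2 * A (n + 1) * A (n - 1) - p (m + 1) * p (m - 1) * (A n)\<^sup>2"
proof -
  have *: "A (n + int k) * A (n - int k) =
     (p (int k))\<^sup>2 * A (n + 1) * A (n - 1) - p (int k + 1) * p (int k - 1) * (A n)\<^sup>2"
    if "int k = \<bar>m\<bar>" for k
    using elliptic_seq_addition_nat[OF assms(1,2), of n k] p nz that by simp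
  show ?thesis
  proof (cases "m \<ge> 0")
    case True
    thus ?thesis using *[of "nat m"] by simp
  next
    case False
    have "p (m + 1) = - p (- m - 1)" "p (m - 1) = - p (- m + 1)"
      using p(1)[of "- m - 1"] p(1)[of "- m + 1"] by (simp_all add: algebra_simps)
    thus ?thesis using *[of "nat (- m)"] False by (simp add: p(1) algebra_simps)
  qed
qed

section \<open>Division polynomials over the fraction field\<close>

definition tangent_num :: "'a::comm_ring_1 weierstrass \<Rightarrow> 'a \<Rightarrow> 'a \<Rightarrow> 'a" where
  "tangent_num E x y = 3 * x\<^sup>2 + 2 * a2 E * x + a4 E - a1 E * y"

definition tangent_den :: "'a::comm_ring_1 weierstrass \<Rightarrow> 'a \<Rightarrow> 'a \<Rightarrow> 'a" where
  "tangent_den E x y = 2 * y + a1 E * x + a3 E"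

definition psi3 :: "'a::comm_ring_1 weierstrass \<Rightarrow> 'a \<Rightarrow> 'a" where
  "psi3 E x = 3 * x ^ 4 + b2 E * x ^ 3 + 3 * b4 E * x\<^sup>2 + 3 * b6 E * x + b8 E"

text \<open>Half the derivative of \<open>4 x^3 + b2 x^2 + 2 b4 x + b6\<close>; it is the value of
  \<open>J\<close> for both families of division polynomials.\<close>

definition somos_inv :: "'a::comm_ring_1 weierstrass \<Rightarrow> 'a \<Rightarrow> 'a" where
  "somos_inv E x = 6 * x\<^sup>2 + b2 E * x + b4 E"

lemma somos_inv_eq:
  "somos_inv E x = 2 * tangent_num E x y + a1 E * tangent_den E x y"
  by (simp add: somos_inv_def tangent_num_def tangent_den_def b2_def b4_def algebra_simps
      power2_eq_square)

text \<open>With tangent slope \<open>N / D\<close>, the right-hand side is \<open>D^2\<close> times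
  the difference between \<open>x\<close> and the abscissa of the doubled point. It also exhibits
  \<open>psi3\<close> as \<open>- N^2\<close> modulo \<open>D\<close>.\<close>

lemma psi3_eq:
  fixes E :: "'a::idom weierstrass"
  assumes "weierstrass_poly E x y = 0"
  shows "psi3 E x = - (tangent_num E x y)\<^sup>2 - a1 E * tangent_den E x y * tangent_num E x y
     + (tangent_den E x y)\<^sup>2 * (3 * x + a2 E)"
  using assms
  unfolding weierstrass_poly_def psi3_def tangent_num_def tangent_den_def b2_def b4_def b6_def b8_def
  by algebra

text \<open>The second factor is \<open>x1 - x3\<close> with \<open>x3\<close> the abscissa of the
  sum. On the chord the curve polynomial is \<open>-(x - x1) (x - x2) (x - x3)\<close>; both sides
  are the negative of its derivative at \<open>x1\<close>.\<close>

lemma chord_x_diff: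
  fixes E :: "'a::field weierstrass"
  assumes "weierstrass_poly E x1 y1 = 0" "weierstrass_poly E x2 y2 = 0" "x1 \<noteq> x2"
    and l: "l = (y2 - y1) / (x2 - x1)"
  shows "(x1 - x2) * (2 * x1 + x2 - l\<^sup>2 - a1 E * l + a2 E) =
     tangent_num E x1 y1 - tangent_den E x1 y1 * l"
proof -
  have y2: "y2 = y1 + l * (x2 - x1)" using assms(3) by (simp add: l)
  have "(x1 - x2) * ((x1 - x2) * (2 * x1 + x2 - l\<^sup>2 - a1 E * l + a2 E)
     - (tangent_num E x1 y1 - tangent_den E x1 y1 * l)) = 
    weierstrass_poly E x1 y1 - weierstrass_poly E x2 y2"
    unfolding y2 weierstrass_poly_def tangent_num_def tangent_den_def by algebra
  thus ?thesis using assms by simp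
qed

section \<open>The translated division polynomials in the fraction field\<close>

lemma weierstrass_poly_fgen:
  "weierstrass_poly (curve_of fgen) (fgen X1) (fgen Y1) = 0"
  "weierstrass_poly (curve_of fgen) (fgen X2) (fgen Y2) = 0"
proof -
  have hom: "ring_homomorphism (\<lambda>p. of_rstar (abs_rstar p))"
    using ring_homomorphism_abs_rstar ring_homomorphism_of_rstar
    by (simp add: ring_homomorphism_def)
  note h = ring_homomorphismD[OF hom]
  have "in_ideal (weierstrass_poly (curve_of Var) (Var X1) (Var Y1))"
    "in_ideal (weierstrass_poly (curve_of Var) (Var X2) (Var Y2))"
    unfolding in_ideal_def
    by (rule exI[of _ 1], rule exI[of _ 0], rule exI[of _ 0], simp)
       (rule exI[of _ 0], rule exI[of _ 1], rule exI[of _ 0], simp)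
  hence "abs_rstar (weierstrass_poly (curve_of Var) (Var X1) (Var Y1)) = abs_rstar 0"
    "abs_rstar (weierstrass_poly (curve_of Var) (Var X2) (Var Y2)) = abs_rstar 0"
    by (simp_all add: rstar.abs_eq_iff rstar_rel_def)
  from this[THEN arg_cong[of _ _ of_rstar]]
  show "weierstrass_poly (curve_of fgen) (fgen X1) (fgen Y1) = 0"
    "weierstrass_poly (curve_of fgen) (fgen X2) (fgen Y2) = 0"
    by (simp_all add: weierstrass_poly_def curve_of_def h fgen_def gen_def)
qed

lemma fgen_X1_neq_X2: "fgen X1 \<noteq> fgen X2"
  using cusp_val_nonzero[OF cusp_val_Psim1] by simp

lemma Psi_nonzero: "Psi n \<noteq> 0"
proof (cases "n \<ge> 0")
  case True
  thus ?thesis using is_Psi_up[OF is_Psi_Psi, of "nat (n + 1)"] Psi_up_nonzero by simp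
next
  case False
  thus ?thesis using is_Psi_down[OF is_Psi_Psi, of "nat (2 - n)"] Psi_down_nonzero by simp
qed

lemma Psi_simps:
  "Psi (-1) = fgen X1 - fgen X2" "Psi 0 = 1" "Psi 1 = 1" "Psi 2 = Psi2"
  "Psi (m + 2) * Psi (m - 2) = beta1\<^sup>2 * Psi (m + 1) * Psi (m - 1) - beta2 * (Psi m)\<^sup>2"
  using is_Psi_Psi unfolding is_Psi_def by blast+

abbreviation gen_num :: "rstar fract" where
  "gen_num \<equiv> tangent_num (curve_of fgen) (fgen X1) (fgen Y1)"

abbreviation gen_inv :: "rstar fract" where
  "gen_inv \<equiv> somos_inv (curve_of fgen) (fgen X1)"

abbreviation gen_slope :: "rstar fract" where
  "gen_slope \<equiv> (fgen Y2 - fgen Y1) / (fgen X2 - fgen X1)"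

lemma beta1_eq: "beta1 = tangent_den (curve_of fgen) (fgen X1) (fgen Y1)"
  by (simp add: beta1_def tangent_den_def curve_of_def)

lemma beta2_eq: "beta2 = psi3 (curve_of fgen) (fgen X1)"
  by (simp add: beta2_def psi3_def Let_def)

lemma Psi2_eq: "Psi2 = 2 * fgen X1 + fgen X2 - gen_slope\<^sup>2 - fgen Alpha1 * gen_slope + fgen Alpha2"
  by (simp add: Psi2_def Let_def)

lemma Psi2_chord: "(fgen X1 - fgen X2) * Psi2 = gen_num - beta1 * gen_slope"
  using chord_x_diff[OF weierstrass_poly_fgen fgen_X1_neq_X2 refl]
  by (simp add: Psi2_eq beta1_eq curve_of_def)

lemma gen_inv_eq: "gen_inv = 2 * gen_num + fgen Alpha1 * beta1"
  using somos_inv_eq[of "curve_of fgen" "fgen X1" "fgen Y1"] by (simp add: beta1_eq curve_of_def)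

lemma beta2_tangent:
  "beta2 = - gen_num\<^sup>2 - fgen Alpha1 * beta1 * gen_num + beta1\<^sup>2 * (3 * fgen X1 + fgen Alpha2)"
  using psi3_eq[OF weierstrass_poly_fgen(1)] by (simp add: beta1_eq beta2_eq curve_of_def)

lemma elliptic_seq_Psi: "elliptic_seq (beta1\<^sup>2) beta2 gen_inv Psi"
proof (rule elliptic_seqI[OF Psi_simps(5) _ Psi_nonzero])
  let ?d = "fgen X1 - fgen X2"
  have *: "Psi2 * Psi (-2) = beta1\<^sup>2 * ?d - beta2"
    using Psi_simps(5)[of 0] by (simp add: Psi_simps)
  \<comment> \<open>The factor \<open>Psi2\<close> brings in the product
    \<open>Psi2 * Psi (-2)\<close>, which the recurrence at 0 evaluates.\<close>
  have "?d * Psi2 * (Psi2 * ?d\<^sup>2 + Psi (-2)) = ?d * Psi2 * (gen_inv * ?d - beta1\<^sup>2)"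
    using * Psi2_chord gen_inv_eq beta2_tangent Psi2_eq by algebra
  hence "Psi2 * ?d\<^sup>2 + Psi (-2) = gen_inv * ?d - beta1\<^sup>2"
    using Psi_nonzero[of 2] fgen_X1_neq_X2 by (simp add: Psi_simps)
  thus "Psi 2 * (Psi (-1))\<^sup>2 + Psi (-2) * (Psi 1)\<^sup>2 =
     gen_inv * Psi 1 * Psi 0 * Psi (-1) - beta1\<^sup>2 * Psi 0 ^ 3"
    by (simp add: Psi_simps)
qed

text \<open>As the term at 0 vanishes, the recurrence centred at 2 says nothing about the term at 4.
  Its value is the one that the conserved quantity at 2 forces.\<close>

fun divpoly :: "'a::field \<Rightarrow> 'a \<Rightarrow> 'a \<Rightarrow> nat \<Rightarrow> 'a" where
  "divpoly b c J 0 = 0"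
| "divpoly b c J (Suc 0) = 1"
| "divpoly b c J (Suc (Suc 0)) = b"
| "divpoly b c J (Suc (Suc (Suc 0))) = c"
| "divpoly b c J (Suc (Suc (Suc (Suc 0)))) = b * (J * c - b ^ 4)"
| "divpoly b c J (Suc (Suc (Suc (Suc (Suc n))))) =
     (b\<^sup>2 * divpoly b c J (Suc (Suc (Suc (Suc n)))) * divpoly b c J (Suc (Suc n))
       - c * (divpoly b c J (Suc (Suc (Suc n))))\<^sup>2) / divpoly b c J (Suc n)"

definition divpoly_int :: "'a::field \<Rightarrow> 'a \<Rightarrow> 'a \<Rightarrow> int \<Rightarrow> 'a" where
  "divpoly_int b c J n = (if n \<ge> 0 then divpoly b c J (nat n) else - divpoly b c J (nat (- n)))"

lemma divpoly_int_minus: "divpoly_int b c J (- n) = - divpoly_int b c J n"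
  by (simp add: divpoly_int_def)

lemma divpoly_int_of_nat: "divpoly_int b c J (int n) = divpoly b c J n"
  by (simp add: divpoly_int_def)

lemma divpoly_int_simps:
  "divpoly_int b c J 0 = 0" "divpoly_int b c J 1 = 1" "divpoly_int b c J 2 = b"
  "divpoly_int b c J 3 = c" "divpoly_int b c J 4 = b * (J * c - b ^ 4)"
  "divpoly_int b c J (-1) = -1" "divpoly_int b c J (-2) = - b"
  by (simp_all add: divpoly_int_def eval_nat_numeral)

lemma elliptic_seq_reflect:
  assumes odd: "\<And>k. p (- k) = - p k"
    and rec: "\<And>n. n \<ge> 0 \<Longrightarrow> p (n + 2) * p (n - 2) = \<alpha> * p (n + 1) * p (n - 1) - \<beta> * (p n)\<^sup>2"
    and inv: "\<And>n. n \<ge> 0 \<Longrightarrow> p (n + 2) * (p (n - 1))\<^sup>2 + p (n - 2) * (p (n + 1))\<^sup>2 =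
        J * p (n + 1) * p n * p (n - 1) - \<alpha> * p n ^ 3"
  shows "elliptic_seq \<alpha> \<beta> J p"
  unfolding elliptic_seq_def
proof (intro conjI allI)
  fix n :: int
  have neg: "p (- n + 2) = - p (n - 2)" "p (- n - 2) = - p (n + 2)" 
    "p (- n + 1) = - p (n - 1)" "p (- n - 1) = - p (n + 1)" "p (- n) = - p n"
    unfolding odd[symmetric] by (rule arg_cong[of _ _ p], simp)+
  show "p (n + 2) * p (n - 2) = \<alpha> * p (n + 1) * p (n - 1) - \<beta> * (p n)\<^sup>2"
    using rec[of n] rec[of "- n", unfolded neg] by (cases "n \<ge> 0") (simp_all add: mult_ac)
  show "p (n + 2) * (p (n - 1))\<^sup>2 + p (n - 2) * (p (n + 1))\<^sup>2 =
        J * p (n + 1) * p n * p (n - 1) - \<alpha> * p n ^ 3"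
    using inv[of n] inv[of "- n", unfolded neg]
    by (cases "n \<ge> 0") (simp_all add: mult_ac algebra_simps)
qed

text \<open>The zero at 0 rules out \<open>elliptic_seqI\<close>. The invariant is checked at 0, 1
  and 2 and carried upwards from 2, where only terms of positive index are cancelled; oddness
  supplies the negative indices.\<close>

lemma elliptic_seq_divpoly:
  assumes nz: "\<And>n. n > 0 \<Longrightarrow> divpoly b c J n \<noteq> 0"
  shows "elliptic_seq (b\<^sup>2) c J (divpoly_int b c J)"
proof (rule elliptic_seq_reflect)
  let ?p = "divpoly_int b c J"
  have rec: "?p (int n + 4) * ?p (int n) = b\<^sup>2 * ?p (int n + 3) * ?p (int n + 1) - c * (?p (int n + 2))\<^sup>2" for n
  proof (cases n)
    case 0
    thus ?thesis by (simp add: divpoly_int_simps power2_eq_square)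
  next
    case (Suc k)
    have e: "int (Suc k) + 4 = int (Suc (Suc (Suc (Suc (Suc k)))))"
      "int (Suc k) + 3 = int (Suc (Suc (Suc (Suc k))))"
      "int (Suc k) + 2 = int (Suc (Suc (Suc k)))" "int (Suc k) + 1 = int (Suc (Suc k))"
      by simp_all
    show ?thesis unfolding Suc e divpoly_int_of_nat using nz[of "Suc k"] by simp
  qed
  have rec2: "?p (n + 2) * ?p (n - 2) = b\<^sup>2 * ?p (n + 1) * ?p (n - 1) - c * (?p n)\<^sup>2" if "n \<ge> 2" for n
    using rec[of "nat (n - 2)"] that by (simp add: algebra_simps)
  show "?p (n + 2) * ?p (n - 2) = b\<^sup>2 * ?p (n + 1) * ?p (n - 1) - c * (?p n)\<^sup>2" if "n \<ge> 0" for n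
  proof -
    from that consider "n = 0" | "n = 1" | "n \<ge> 2" by linarith
    thus ?thesis using rec2[of n] by cases (simp_all add: divpoly_int_simps power2_eq_square)
  qed
  show "?p (- k) = - ?p k" for k by (rule divpoly_int_minus)
  let ?T = "\<lambda>n. ?p (n + 2) * (?p (n - 1))\<^sup>2 + ?p (n - 2) * (?p (n + 1))\<^sup>2 =
        J * ?p (n + 1) * ?p n * ?p (n - 1) - b\<^sup>2 * ?p n ^ 3"
  have "?T n" if "n \<ge> 2" for n
    using that
  proof (induction n rule: int_ge_induct)
    case base
    show ?case by (simp add: divpoly_int_simps algebra_simps eval_nat_numeral)
  next
    case (step i)
    have 1: "?p (i + 3) * ?p (i - 1) = b\<^sup>2 * ?p (i + 2) * ?p i - c * (?p (i + 1))\<^sup>2"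
      using rec2[of "i + 1"] step(1) by (simp add: algebra_simps)
    have "?p (i - 1) \<noteq> 0" using nz[of "nat (i - 1)"] step(1) by (simp add: divpoly_int_def)
    from somos_invariant_step[OF rec2[OF step(1)] 1 step(2) this] show ?case
      by (simp add: algebra_simps)
  qed
  thus "?T n" if "n \<ge> 0" for n
  proof -
    from that consider "n = 0" | "n = 1" | "n \<ge> 2" by linarith
    thus ?thesis using \<open>n \<ge> 2 \<Longrightarrow> ?T n\<close> by cases (simp_all add: divpoly_int_simps power2_eq_square)
  qed
qed

section \<open>Nonvanishing by specialization to the cusp\<close>

lemma cusp_val_gen_inv: "cusp_val gen_inv 6"
proof (rule cusp_val_cong)
  show "cusp_val gen_inv (somos_inv (curve_of cusp) (cusp X1))"
    unfolding somos_inv_def b2_def b4_def curve_of_def weierstrass.simps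
    by (intro cusp_val_intros)
qed (simp add: somos_inv_def b2_def b4_def curve_of_def cusp_def)

text \<open>The specialization that shows the \<open>Psi\<close> to be nonzero sends the division
  polynomials to the natural numbers, so those of positive index are nonzero too.\<close>

lemma cusp_val_divpoly: "cusp_val (divpoly beta1 beta2 gen_inv n) (of_nat n)"
proof (induction n rule: less_induct)
  case (less n)
  consider "n = 0" | "n = 1" | "n = 2" | "n = 3" | "n = Suc (Suc (Suc (Suc 0)))"
    | k where "n = Suc (Suc (Suc (Suc (Suc k))))"
    by (metis One_nat_def Suc_1 not0_implies_Suc numeral_3_eq_3)
  thus ?case
  proof cases
    case 5
    have "cusp_val (beta1 * (gen_inv * beta2 - beta1 ^ 4)) (2 * (6 * 3 - 2 ^ 4))"
      by (intro cusp_val_intros cusp_val_beta1 cusp_val_beta2 cusp_val_gen_inv)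
    thus ?thesis by (simp add: 5 eval_nat_numeral)
  next
    case 6
    let ?w = "of_nat :: nat \<Rightarrow> rat"
    have nz: "?w (Suc k) \<noteq> 0" by simp
    have "cusp_val (divpoly beta1 beta2 gen_inv n)
       ((2\<^sup>2 * ?w (Suc (Suc (Suc (Suc k)))) * ?w (Suc (Suc k)) - 3 * (?w (Suc (Suc (Suc k))))\<^sup>2)
          / ?w (Suc k))"
      unfolding 6 divpoly.simps
      by (intro cusp_val_divide cusp_val_diff cusp_val_mult cusp_val_power
            cusp_val_beta1 cusp_val_beta2 less.IH nz) (simp_all add: 6)
    moreover have "(2\<^sup>2 * ?w (Suc (Suc (Suc (Suc k)))) * ?w (Suc (Suc k)) - 3 * (?w (Suc (Suc (Suc k))))\<^sup>2)
          / ?w (Suc k) = ?w n"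
      using nz unfolding 6 by (simp add: field_simps power2_eq_square)
    ultimately show ?thesis by (rule cusp_val_cong)
  qed (use cusp_val_0 cusp_val_1 cusp_val_beta1 cusp_val_beta2 in
        \<open>simp_all add: numeral_2_eq_2 numeral_3_eq_3\<close>)
qed

abbreviation psi :: "int \<Rightarrow> rstar fract" where
  "psi \<equiv> divpoly_int beta1 beta2 gen_inv"

lemma divpoly_nonzero: "n > 0 \<Longrightarrow> divpoly beta1 beta2 gen_inv n \<noteq> 0"
  by (rule cusp_val_nonzero[OF cusp_val_divpoly]) simp

lemma psi_nonzero: "n > 0 \<Longrightarrow> psi n \<noteq> 0"
  using divpoly_nonzero[of "nat n"] by (simp add: divpoly_int_def)

lemma beta1_nonzero: "beta1 \<noteq> 0"
  by (rule cusp_val_nonzero[OF cusp_val_beta1]) simp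

lemma elliptic_seq_psi: "elliptic_seq (beta1\<^sup>2) beta2 gen_inv psi"
  by (rule elliptic_seq_divpoly[OF divpoly_nonzero])

section \<open>Addition and doubling formulas\<close>

lemma Psi_addition:
  "Psi (n + m) * Psi (n - m) = (psi m)\<^sup>2 * Psi (n + 1) * Psi (n - 1)
     - psi (m + 1) * psi (m - 1) * (Psi n)\<^sup>2"
  by (rule elliptic_seq_addition[OF elliptic_seq_Psi elliptic_seq_psi])
     (simp_all add: divpoly_int_minus divpoly_int_simps Psi_nonzero)

text \<open>The bound keeps index 0, the zero of \<open>psi\<close>, out of the window where
  nonvanishing is required.\<close>

lemma psi_addition:
  assumes "\<bar>m\<bar> < n"
  shows "psi (n + m) * psi (n - m) = (psi m)\<^sup>2 * psi (n + 1) * psi (n - 1)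
     - psi (m + 1) * psi (m - 1) * (psi n)\<^sup>2"
  by (rule elliptic_seq_addition[OF elliptic_seq_psi elliptic_seq_psi])
     (use assms in \<open>auto simp add: divpoly_int_minus divpoly_int_simps intro!: psi_nonzero\<close>)

lemma psi_odd:
  assumes "n \<ge> 0"
  shows "psi (2 * n + 1) = psi (n + 2) * psi n ^ 3 - psi (n - 1) * psi (n + 1) ^ 3"
proof -
  have e: "n + 1 + n = 2 * n + 1" "n + 1 - n = 1" "n + 1 + 1 = n + 2" "n + 1 - 1 = n" by simp_all
  have "psi (2 * n + 1) * psi 1 = (psi n)\<^sup>2 * psi (n + 2) * psi n - psi (n + 1) * psi (n - 1) * (psi (n + 1))\<^sup>2"
    using psi_addition[of n "n + 1"] assms unfolding e by simp
  thus ?thesis by (simp add: divpoly_int_simps power2_eq_square power3_eq_cube mult_ac)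
qed

lemma psi_even:
  assumes "n \<ge> 1"
  shows "psi (2 * n) * beta1 = psi n * (psi (n + 2) * (psi (n - 1))\<^sup>2 - psi (n - 2) * (psi (n + 1))\<^sup>2)"
proof -
  have e: "n + 1 + (n - 1) = 2 * n" "n + 1 - (n - 1) = 2" "n + 1 + 1 = n + 2" "n + 1 - 1 = n"
    "n - 1 + 1 = n" "n - 1 - 1 = n - 2" by simp_all
  have "psi (2 * n) * psi 2 = (psi (n - 1))\<^sup>2 * psi (n + 2) * psi n - psi n * psi (n - 2) * (psi (n + 1))\<^sup>2"
    using psi_addition[of "n - 1" "n + 1"] assms unfolding e by simp
  thus ?thesis by (simp add: divpoly_int_simps algebra_simps)
qed

lemma Psi_even: "Psi (2 * n) = (psi n)\<^sup>2 * Psi (n + 1) * Psi (n - 1) - psi (n + 1) * psi (n - 1) * (Psi n)\<^sup>2"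
  using Psi_addition[of n n] by (simp add: Psi_simps)

lemma Psi_odd:
  "Psi (2 * n - 1) = (psi (n - 1))\<^sup>2 * Psi (n + 1) * Psi (n - 1) - psi n * psi (n - 2) * (Psi n)\<^sup>2"
proof -
  have e: "n + (n - 1) = 2 * n - 1" "n - (n - 1) = 1" "n - 1 + 1 = n" "n - 1 - 1 = n - 2" by simp_all
  show ?thesis using Psi_addition[of n "n - 1"] unfolding e by (simp add: Psi_simps)
qed

section \<open>Integrality\<close>

lemmas of_rstar_hom = ring_homomorphismD[OF ring_homomorphism_of_rstar]

text \<open>Membership in the subring \<open>R*\<close> itself, not integral dependence over
  it.\<close>

definition integral :: "rstar fract \<Rightarrow> bool" where
  "integral z \<longleftrightarrow> z \<in> range of_rstar"

lemma integral_of_rstar: "integral (of_rstar x)"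
  by (simp add: integral_def)

lemma integral_add: "integral x \<Longrightarrow> integral y \<Longrightarrow> integral (x + y)"
  unfolding integral_def by (auto simp flip: of_rstar_hom)

lemma integral_diff: "integral x \<Longrightarrow> integral y \<Longrightarrow> integral (x - y)"
  unfolding integral_def by (auto simp flip: of_rstar_hom)

lemma integral_mult: "integral x \<Longrightarrow> integral y \<Longrightarrow> integral (x * y)"
  unfolding integral_def by (auto simp flip: of_rstar_hom)

lemma integral_minus: "integral x \<Longrightarrow> integral (- x)"
  unfolding integral_def by (auto simp flip: of_rstar_hom)

lemma integral_power: "integral x \<Longrightarrow> integral (x ^ n)"
  unfolding integral_def by (auto simp flip: of_rstar_hom)

lemma integral_numeral: "integral (numeral k)"
  unfolding of_rstar_hom(10)[symmetric] by (rule integral_of_rstar)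

lemma integral_0: "integral 0" and integral_1: "integral 1"
  using integral_of_rstar[of 0] integral_of_rstar[of 1] by (simp_all add: of_rstar_hom)

lemma integral_fgen: "integral (fgen v)"
  unfolding fgen_def by (rule integral_of_rstar)

lemmas integral_intros = integral_add integral_diff integral_mult integral_minus integral_power
  integral_numeral integral_0 integral_1 integral_fgen

text \<open>\<open>x1 - x2\<close> is a unit of \<open>R*\<close>, its inverse being the adjoined
  \<open>Inv12\<close>.\<close>

lemma integral_divide_X1_X2: 
  assumes "integral x" "x = y * (fgen X1 - fgen X2)"
  shows "integral y"
proof -
  have "fgen Inv12 * (fgen X1 - fgen X2) = 1"
    using gen_Inv12[THEN arg_cong[of _ _ of_rstar]] by (simp add: fgen_def of_rstar_hom)
  hence "y = x * fgen Inv12" using assms(2) by (simp add: mult_ac)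
  thus ?thesis using assms(1) by (auto intro: integral_intros)
qed

lemma integral_gen_slope: "integral gen_slope"
  by (rule integral_divide_X1_X2[of "fgen Y1 - fgen Y2"])
     (use fgen_X1_neq_X2 in \<open>auto intro!: integral_intros simp: divide_simps algebra_simps\<close>)

lemma integral_beta1: "integral beta1"
  unfolding beta1_def by (intro integral_intros)

lemma integral_gen_num: "integral gen_num"
  unfolding tangent_num_def curve_of_def weierstrass.simps by (intro integral_intros)

lemma integral_gen_inv: "integral gen_inv"
  unfolding gen_inv_eq by (intro integral_intros integral_gen_num integral_beta1)

lemma integral_beta2: "integral beta2"
  unfolding beta2_tangent by (intro integral_intros integral_gen_num integral_beta1)

lemma integral_Psi2: "integral Psi2"
  unfolding Psi2_eq by (intro integral_intros integral_gen_slope)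

text \<open>The even division polynomials have to be divided by \<open>\<beta>\<^sub>1\<close> before the doubling
  formulas give a recursion without denominators.\<close>

lemma integral_psi_div:
  "integral (divpoly beta1 beta2 gen_inv n) \<and>
   (even n \<longrightarrow> (\<exists>u. integral u \<and> divpoly beta1 beta2 gen_inv n = beta1 * u))"
proof (induction n rule: less_induct)
  case (less n)
  let ?p = "divpoly beta1 beta2 gen_inv"
  have I: "integral (psi (int k))" if "k < n" for k
    using less.IH that unfolding divpoly_int_of_nat by blast
  have D: "\<exists>u. integral u \<and> psi (int k) = beta1 * u" if "k < n" "even k" for k
    using less.IH that unfolding divpoly_int_of_nat by blast
  consider "n = 0" | "n = 1" | "n = 2" | "n = 3" | "n = 4" | "n \<ge> 5" by linarith
  thus ?case
  proof cases
    case 3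
    thus ?thesis using integral_beta1 integral_1 by (auto simp: numeral_2_eq_2 intro!: exI[of _ 1])
  next
    case 5
    have "integral (gen_inv * beta2 - beta1 ^ 4)"
      by (intro integral_intros integral_gen_inv integral_beta1 integral_beta2)
    moreover have "?p n = beta1 * (gen_inv * beta2 - beta1 ^ 4)"
      by (simp add: 5 numeral_eq_Suc)
    ultimately show ?thesis using integral_beta1 by (auto intro: integral_intros)
  next
    case 6
    show ?thesis
    proof (cases "even n")
      case False
      then obtain k where k: "n = 2 * k + 1" by (elim oddE)
      have e: "int n = 2 * int k + 1" "int k + 2 = int (k + 2)" "int k + 1 = int (k + 1)"
        "int k - 1 = int (k - 1)" using k 6 by auto
      have "integral (psi (int n))"
        unfolding e(1) using k 6
        by (subst psi_odd) (auto simp only: e(2-) intro!: integral_intros I)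
      thus ?thesis using False by (simp add: divpoly_int_of_nat)
    next
      case True
      then obtain k where k: "n = 2 * k" by (elim evenE)
      have e: "int n = 2 * int k" "int k + 2 = int (k + 2)" "int k + 1 = int (k + 1)"
        "int k - 1 = int (k - 1)" "int k - 2 = int (k - 2)" using k 6 by auto
      have eq: "psi (int n) * beta1 = psi (int k) * (psi (int (k + 2)) * (psi (int (k - 1)))\<^sup>2
         - psi (int (k - 2)) * (psi (int (k + 1)))\<^sup>2)"
        using psi_even[of "int k"] k 6 unfolding e by simp
      have Ik: "integral (psi (int k))" "integral (psi (int (k + 2)))" "integral (psi (int (k - 2)))"
        by (rule I; use k 6 in linarith)+
      \<comment> \<open>One factor \<open>beta1\<close> is owed to \<open>psi_even\<close>, the
        other is the claimed divisibility. For even \<open>k\<close> one comes from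
        \<open>psi k\<close> and one from the outer terms; for odd \<open>k\<close> both come from
        the squares.\<close>
      have "\<exists>u. integral u \<and> psi (int n) * beta1 = beta1 * beta1 * u"
      proof (cases "even k")
        case True
        have "k < n" "k + 2 < n" "k - 2 < n" "even (k + 2)" "even (k - 2)" 
          using k 6 True by auto
        then obtain u v w where "integral u" "integral v" "integral w" 
          and "psi (int k) = beta1 * u" "psi (int (k + 2)) = beta1 * v" "psi (int (k - 2)) = beta1 * w"
          using D True by metis
        moreover have "integral (psi (int (k - 1)))" "integral (psi (int (k + 1)))"
          by (rule I; use k 6 in linarith)+
        ultimately show ?thesis unfolding eq
          by (intro exI[of _ "u * (v * (psi (int (k - 1)))\<^sup>2 - w * (psi (int (k + 1)))\<^sup>2)"])
             (auto intro!: integral_intros simp del: of_nat_add simp: algebra_simps)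
      next
        case False
        have "k - 1 < n" "k + 1 < n" "even (k - 1)" "even (k + 1)" 
          using k 6 False by auto
        then obtain v w where "integral v" "integral w" 
          and "psi (int (k - 1)) = beta1 * v" "psi (int (k + 1)) = beta1 * w"
          using D by metis
        thus ?thesis unfolding eq using Ik
          by (intro exI[of _ "psi (int k) * (psi (int (k + 2)) * v\<^sup>2 - psi (int (k - 2)) * w\<^sup>2)"])
             (auto intro!: integral_intros simp del: of_nat_add simp: algebra_simps power2_eq_square)
      qed
      then obtain u where u: "integral u" "psi (int n) * beta1 = beta1 * beta1 * u" by blast
      hence "?p n = beta1 * u" using beta1_nonzero by (simp add: divpoly_int_of_nat)
      thus ?thesis using u(1) integral_beta1 by (auto intro: integral_intros)
    qed
  qed (auto simp: integral_0 integral_1 integral_beta2 numeral_3_eq_3 intro!: exI[of _ 0])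
qed

lemma integral_psi: "integral (psi n)"
  using integral_psi_div by (auto simp: divpoly_int_def intro: integral_minus)

text \<open>The recurrence at 0 would require division by \<open>Psi2\<close>; the conserved
  quantity at 0 contains \<open>Psi (-2)\<close> with coefficient 1.\<close>

lemma integral_Psi_minus2: "integral (Psi (-2))"
proof -
  have "Psi (-2) = gen_inv * (fgen X1 - fgen X2) - beta1\<^sup>2 - Psi2 * (fgen X1 - fgen X2)\<^sup>2"
    using elliptic_seqD(2)[OF elliptic_seq_Psi, of 0] by (simp add: Psi_simps algebra_simps)
  thus ?thesis
    by (auto intro!: integral_intros integral_gen_inv integral_beta1 integral_Psi2)
qed

lemma Psi_3: "Psi 3 * (fgen X1 - fgen X2) = beta1\<^sup>2 * Psi2 - beta2"
  using Psi_simps(5)[of 1] by (simp add: Psi_simps)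

lemma integral_Psi: "integral (Psi n)"
proof (induction "nat \<bar>n\<bar>" arbitrary: n rule: less_induct)
  case less
  \<comment> \<open>The doubling formulas need the indices \<open>k - 1\<close>, \<open>k\<close>,
    \<open>k + 1\<close>, which are all smaller than \<open>n\<close> in absolute value exactly when
    \<open>n\<close> lies outside -2, ..., 3.\<close>
  consider "n = -2" | "n = -1" | "n = 0" | "n = 1" | "n = 2" | "n = 3"
    | k where "n = 2 * k" "\<bar>k\<bar> \<ge> 2" | k where "n = 2 * k - 1" "k \<ge> 3 \<or> k \<le> -1"
  proof -
    consider k where "n = 2 * k" | k where "n = 2 * k - 1"
      by (metis evenE oddE add_diff_cancel_right' even_plus_one_iff odd_pos diff_add_cancel odd_one even_diff)
    thus ?thesis using that by cases (smt (verit))+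
  qed
  thus ?case
  proof cases
    case 6
    have "integral (beta1\<^sup>2 * Psi2 - beta2)"
      by (intro integral_intros integral_beta1 integral_beta2 integral_Psi2)
    thus ?thesis unfolding 6 by (rule integral_divide_X1_X2) (rule Psi_3[symmetric])
  next
    case 7
    have "integral (Psi k)" "integral (Psi (k + 1))" "integral (Psi (k - 1))"
      by (rule less; use 7 in arith)+
    thus ?thesis
      by (simp add: 7(1) Psi_even integral_intros integral_psi)
  next
    case 8
    have "integral (Psi k)" "integral (Psi (k + 1))" "integral (Psi (k - 1))"
      by (rule less; use 8 in arith)+
    thus ?thesis
      by (simp add: 8(1) Psi_odd integral_intros integral_psi)
  qed (auto simp: Psi_simps intro!: integral_intros integral_Psi_minus2 integral_Psi2)
qed

section \<open>Congruences modulo \<open>\<beta>\<^sub>1\<close>\<close>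

definition cong_beta1 :: "rstar fract \<Rightarrow> rstar fract \<Rightarrow> bool" where
  "cong_beta1 x y \<longleftrightarrow> integral x \<and> integral y \<and> (\<exists>u. integral u \<and> x - y = beta1 * u)"

lemma cong_beta1I: "integral y \<Longrightarrow> integral u \<Longrightarrow> x = y + beta1 * u \<Longrightarrow> cong_beta1 x y"
  unfolding cong_beta1_def by (auto intro!: integral_intros integral_beta1)

lemma cong_beta1E:
  assumes "cong_beta1 x y"
  obtains u where "integral x" "integral y" "integral u" "x = y + beta1 * u"
  using assms unfolding cong_beta1_def by (metis add.commute diff_add_cancel)

lemma cong_beta1_refl: "integral x \<Longrightarrow> cong_beta1 x x"
  by (rule cong_beta1I[of _ 0]) (auto intro: integral_intros)

lemma cong_beta1_sym: "cong_beta1 x y \<Longrightarrow> cong_beta1 y x"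
  by (erule cong_beta1E, rule_tac u = "- u" in cong_beta1I) (auto intro: integral_intros)

lemma cong_beta1_trans: "cong_beta1 x y \<Longrightarrow> cong_beta1 y z \<Longrightarrow> cong_beta1 x z"
  by (elim cong_beta1E, rule_tac u = "u + ua" in cong_beta1I)
     (auto intro: integral_intros simp: algebra_simps)

lemma cong_beta1_diff:
  "cong_beta1 x y \<Longrightarrow> cong_beta1 x' y' \<Longrightarrow> cong_beta1 (x - x') (y - y')"
  by (elim cong_beta1E, rule_tac u = "u - ua" in cong_beta1I)
     (auto intro: integral_intros simp: algebra_simps)

lemma cong_beta1_mult:
  "cong_beta1 x y \<Longrightarrow> cong_beta1 x' y' \<Longrightarrow> cong_beta1 (x * x') (y * y')"
  by (elim cong_beta1E, rule_tac u = "u * x' + y * ua" in cong_beta1I)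
     (auto intro!: integral_intros integral_beta1 simp: algebra_simps)

lemma cong_beta1_power: "cong_beta1 x y \<Longrightarrow> cong_beta1 (x ^ n) (y ^ n)"
  by (induction n) (auto intro: cong_beta1_mult cong_beta1_refl integral_1)

lemmas cong_beta1_intros = cong_beta1_diff cong_beta1_mult cong_beta1_power

lemma cong_beta1_cong: "cong_beta1 x y \<Longrightarrow> y = z \<Longrightarrow> cong_beta1 x z"
  by simp

lemma cong_beta1_cancel:
  assumes "cong_beta1 (x * (fgen X1 - fgen X2)) (y * (fgen X1 - fgen X2))"
    and "integral x" "integral y"
  shows "cong_beta1 x y"
proof -
  let ?d = "fgen X1 - fgen X2"
  obtain u where u: "integral u" "x * ?d = y * ?d + beta1 * u"
    using assms(1) by (elim cong_beta1E)
  have d: "?d \<noteq> 0" using fgen_X1_neq_X2 by simp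
  have "integral (u / ?d)" using u(1) by (rule integral_divide_X1_X2) (use d in simp)
  moreover have "(x - (y + beta1 * (u / ?d))) * ?d = 0"
    using u(2) d by (simp add: left_diff_distrib distrib_right)
  hence "x = y + beta1 * (u / ?d)" using d by simp
  ultimately show ?thesis using assms(3) by (intro cong_beta1I)
qed

section \<open>Closed forms modulo \<open>beta1\<close>\<close>

abbreviation gen_prod :: "rstar fract" where
  "gen_prod \<equiv> (fgen X1 - fgen X2) * Psi2"

text \<open>The closed forms below are zero or such monomials up to sign. Keeping the monomial
  folded reduces their comparison to one of exponents.\<close>

definition d_Psi2_mono :: "nat \<Rightarrow> nat \<Rightarrow> rstar fract" where
  "d_Psi2_mono a b = (fgen X1 - fgen X2) ^ a * Psi2 ^ b"

lemma d_Psi2_mono_simps: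
  "d_Psi2_mono a b * d_Psi2_mono a' b' = d_Psi2_mono (a + a') (b + b')"
  "d_Psi2_mono a b * (d_Psi2_mono a' b' * z) = d_Psi2_mono (a + a') (b + b') * z"
  "d_Psi2_mono a b ^ n = d_Psi2_mono (a * n) (b * n)"
  by (simp_all add: d_Psi2_mono_def power_add power_mult power_mult_distrib)

lemma gen_prod_mono: "gen_prod = d_Psi2_mono 1 1"
  by (simp add: d_Psi2_mono_def)

lemma integral_gen_prod: "integral gen_prod"
  by (intro integral_intros integral_Psi2)

lemma cong_gen_num: "cong_beta1 gen_num gen_prod"
  by (rule cong_beta1I[OF integral_gen_prod integral_gen_slope]) (simp add: Psi2_chord)

lemma cong_beta2: "cong_beta1 beta2 (- gen_prod\<^sup>2)"
proof -
  have "cong_beta1 beta2 (0 - gen_num\<^sup>2)"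
    by (rule cong_beta1I[where u = "beta1 * (3 * fgen X1 + fgen Alpha2) - fgen Alpha1 * gen_num"])
       (auto simp: beta2_tangent algebra_simps power2_eq_square
          intro!: integral_intros integral_gen_num integral_beta1)
  moreover have "cong_beta1 (0 - gen_num\<^sup>2) (0 - gen_prod\<^sup>2)"
    by (intro cong_beta1_intros cong_beta1_refl integral_0 cong_gen_num)
  ultimately show ?thesis by (auto dest: cong_beta1_trans)
qed

lemma cong_psi_even: "cong_beta1 (psi (2 * int k)) 0"
proof -
  obtain u where "integral u" "psi (int (2 * k)) = beta1 * u"
    using integral_psi_div[of "2 * k"] unfolding divpoly_int_of_nat by auto
  thus ?thesis by (intro cong_beta1I[of _ u]) (auto intro: integral_0)
qed

text \<open>Modulo \<open>beta1\<close> the generic point behaves like one of order two: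
  \<open>psi\<close> vanishes at even indices, so one summand of \<open>psi_odd\<close> drops out
  and the other is a product of known monomials.\<close>

lemma cong_psi_odd:
  "cong_beta1 (psi (2 * int k + 1)) ((- 1) ^ k * d_Psi2_mono (k * (k + 1)) (k * (k + 1)))"
proof (induction k rule: less_induct)
  case (less k)
  let ?c = "\<lambda>k. (- 1) ^ k * d_Psi2_mono (k * (k + 1)) (k * (k + 1))"
  \<comment> \<open>For \<open>k = 1\<close> the formula would refer to \<open>psi 3\<close>
    itself.\<close>
  consider "k = 0" | "k = 1" | i where "k = 2 * (i + 1)" | i where "k = 2 * (i + 1) + 1"
  proof -
    have "k = 0 \<or> k = 1 \<or> (\<exists>i. k = 2 * (i + 1)) \<or> (\<exists>i. k = 2 * (i + 1) + 1)" by presburger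
    thus ?thesis using that by blast
  qed
  thus ?case
  proof cases
    case 1
    thus ?thesis by (simp add: divpoly_int_simps cong_beta1_refl integral_1 d_Psi2_mono_def)
  next
    case 2
    thus ?thesis
      using cong_beta2 by (simp add: divpoly_int_simps d_Psi2_mono_def power2_eq_square mult_ac)
  next
    case 3
    define j where "j = i + 1"
    have e: "psi (int k + 2) = psi (2 * int (j + 1))" "psi (int k) = psi (2 * int j)"
      "psi (int k - 1) = psi (2 * int i + 1)" "psi (int k + 1) = psi (2 * int j + 1)" by (simp_all add: 3 j_def algebra_simps)
    have "cong_beta1 (psi (int k + 2) * psi (int k) ^ 3 - psi (int k - 1) * psi (int k + 1) ^ 3)
       (0 * 0 ^ 3 - ?c i * ?c j ^ 3)"
      unfolding e by (intro cong_beta1_intros cong_psi_even less.IH) (simp_all add: 3 j_def)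
    thus ?thesis
      unfolding psi_odd[of "int k", simplified]
    proof (rule cong_beta1_cong)
      show "0 * 0 ^ 3 - ?c i * ?c j ^ 3 = ?c k"
        by (cases "even i")
           (simp_all add: 3 j_def algebra_simps power_mult_distrib d_Psi2_mono_simps,
             (simp_all add: eval_nat_numeral)?)
    qed
  next
    case 4
    define j where "j = i + 1"
    have kj: "k = 2 * j + 1" by (simp add: 4 j_def)
    have e: "psi (int k + 2) = psi (2 * int (j + 1) + 1)" "psi (int k) = psi (2 * int j + 1)"
      "psi (int k - 1) = psi (2 * int j)" "psi (int k + 1) = psi (2 * int (j + 1))" by (simp_all add: 4 j_def algebra_simps)
    have "cong_beta1 (psi (int k + 2) * psi (int k) ^ 3 - psi (int k - 1) * psi (int k + 1) ^ 3)
       (?c (j + 1) * ?c j ^ 3 - 0 * 0 ^ 3)"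
      unfolding e by (intro cong_beta1_intros cong_psi_even less.IH) (simp_all add: 4 j_def)
    thus ?thesis
      unfolding psi_odd[of "int k", simplified]
    proof (rule cong_beta1_cong)
      show "?c (j + 1) * ?c j ^ 3 - 0 * 0 ^ 3 = ?c k"
        by (cases "even j")
           (simp_all add: kj algebra_simps power_mult_distrib d_Psi2_mono_simps,
             (simp_all add: eval_nat_numeral)?)
    qed
  qed
qed


text \<open>In each doubling formula one summand contains \<open>psi\<close> at even indices and
  vanishes modulo \<open>beta1\<close>; the other is a product of known monomials.\<close>

lemma cong_Psi:
  "cong_beta1 (Psi (2 * int k + 1)) (d_Psi2_mono (k * k) (k * (k + 1))) \<and>
     cong_beta1 (Psi (2 * int k + 2)) (d_Psi2_mono (k * (k + 1)) ((k + 1) * (k + 1)))"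
proof (induction k rule: less_induct)
  case (less k)
  let ?a = "\<lambda>k. d_Psi2_mono (k * k) (k * (k + 1))"
  let ?b = "\<lambda>k. d_Psi2_mono (k * (k + 1)) ((k + 1) * (k + 1))"
  let ?c = "\<lambda>k. (- 1) ^ k * d_Psi2_mono (k * (k + 1)) (k * (k + 1))"
  have IH: "cong_beta1 (Psi (2 * int i + 1)) (?a i)" "cong_beta1 (Psi (2 * int i + 2)) (?b i)"
    if "i < k" for i using less.IH that by blast+
  note [intro] = cong_beta1_refl integral_Psi integral_psi
  note intros = cong_beta1_intros cong_psi_even cong_psi_odd
  have e: "2 * int k + 2 - 1 = 2 * int k + 1" "2 * (int k + 1) = 2 * int k + 2"
    "int k + 1 + 1 = int k + 2" "int k + 1 - 1 = int k" "int k + 1 - 2 = int k - 1" by simp_all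
  note e1 = Psi_odd[of "int k + 1", unfolded e] and e2 = Psi_even[of "int k + 1", unfolded e]
  show ?case
  proof (cases "even k")
    case True
    then obtain j where k: "k = 2 * j" by (elim evenE)
    show ?thesis
    proof (cases j)
      case 0
      thus ?thesis
        by (simp add: k Psi_simps cong_beta1_refl integral_1 integral_Psi2 d_Psi2_mono_def)
    next
      case (Suc i)
      have e: "psi (int k) = psi (2 * int j)" "psi (int k + 1) = psi (2 * int j + 1)" 
        "psi (int k - 1) = psi (2 * int i + 1)" "psi (int k + 2) = psi (2 * int (j + 1))"
        "Psi (int k + 1) = Psi (2 * int j + 1)" "Psi (int k) = Psi (2 * int i + 2)" 
        "Psi (int k + 2) = Psi (2 * int j + 2)"
        by (simp_all add: k Suc algebra_simps)
      have c1: "cong_beta1 ((psi (int k))\<^sup>2 * Psi (int k + 2) * Psi (int k) - psi (int k + 1) * psi (int k - 1) * (Psi (int k + 1))\<^sup>2)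
         (0\<^sup>2 * ?b j * ?b i - ?c j * ?c i * (?a j)\<^sup>2)"
        unfolding e by (intro intros IH) (simp_all add: k Suc)
      have q1: "0\<^sup>2 * ?b j * ?b i - ?c j * ?c i * (?a j)\<^sup>2 = ?a k"
        by (cases "even i")
           (simp_all add: k Suc algebra_simps power_mult_distrib d_Psi2_mono_simps,
             (simp_all add: eval_nat_numeral)?)
      have c2: "cong_beta1 ((psi (int k + 1))\<^sup>2 * Psi (int k + 2) * Psi (int k) - psi (int k + 2) * psi (int k) * (Psi (int k + 1))\<^sup>2)
         ((?c j)\<^sup>2 * ?b j * ?b i - 0 * 0 * (?a j)\<^sup>2)"
        unfolding e by (intro intros IH) (simp_all add: k Suc)
      have q2: "(?c j)\<^sup>2 * ?b j * ?b i - 0 * 0 * (?a j)\<^sup>2 = ?b k"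
        by (cases "even i")
           (simp_all add: k Suc algebra_simps power_mult_distrib d_Psi2_mono_simps,
             (simp_all add: eval_nat_numeral)?)
      show ?thesis
        unfolding e1 e2 using cong_beta1_cong[OF c1 q1] cong_beta1_cong[OF c2 q2] by blast
    qed
  next
    case False
    then obtain j where k: "k = 2 * j + 1" by (elim oddE)
    have e: "psi (int k) = psi (2 * int j + 1)" "psi (int k + 1) = psi (2 * int (j + 1))" 
      "psi (int k - 1) = psi (2 * int j)" "psi (int k + 2) = psi (2 * int (j + 1) + 1)"
      "Psi (int k + 1) = Psi (2 * int j + 2)" "Psi (int k) = Psi (2 * int j + 1)" 
      "Psi (int k + 2) = Psi (2 * int (j + 1) + 1)"
      by (simp_all add: k algebra_simps)
    have c1: "cong_beta1 (Psi (2 * int k + 1)) (?a k)"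
    \<comment> \<open>For \<open>k = 1\<close> the doubling formula refers to \<open>Psi 3\<close>
      itself, so the recurrence at 1 is used and the unit \<open>x1 - x2\<close> is
      cancelled.\<close>
    proof (cases "j = 0")
      case True
      define d where "d = fgen X1 - fgen X2"
      have "cong_beta1 (Psi 3 * d) (beta1 * (beta1 * Psi2) - (- gen_prod\<^sup>2))"
        unfolding d_def Psi_3
        by (subst power2_eq_square, subst mult.assoc)
           (intro cong_beta1_diff cong_beta2 cong_beta1_refl integral_intros integral_beta1 integral_Psi2)
      moreover have "cong_beta1 (beta1 * (beta1 * Psi2) - (- gen_prod\<^sup>2)) (d * Psi2\<^sup>2 * d)"
        by (rule cong_beta1I[of _ "beta1 * Psi2"])
           (auto simp: d_def algebra_simps power2_eq_square
              intro!: integral_intros integral_beta1 integral_Psi2)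
      ultimately have "cong_beta1 (Psi 3 * d) (d * Psi2\<^sup>2 * d)" by (rule cong_beta1_trans)
      hence "cong_beta1 (Psi 3) (d * Psi2\<^sup>2)"
        unfolding d_def 
        by (rule cong_beta1_cancel) (auto intro!: integral_intros integral_Psi2)
      thus ?thesis by (simp add: k True d_Psi2_mono_def d_def power2_eq_square)
    next
      case False
      have c1: "cong_beta1 ((psi (int k))\<^sup>2 * Psi (int k + 2) * Psi (int k) - psi (int k + 1) * psi (int k - 1) * (Psi (int k + 1))\<^sup>2)
         ((?c j)\<^sup>2 * ?a (j + 1) * ?a j - 0 * 0 * (?b j)\<^sup>2)"
        unfolding e by (intro intros IH) (use False in \<open>simp_all add: k\<close>)
      have q1: "(?c j)\<^sup>2 * ?a (j + 1) * ?a j - 0 * 0 * (?b j)\<^sup>2 = ?a k"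
        by (cases "even j")
           (simp_all add: k algebra_simps power_mult_distrib d_Psi2_mono_simps,
             (simp_all add: eval_nat_numeral)?)
      show ?thesis unfolding e1 by (rule cong_beta1_cong[OF c1 q1])
    qed
    \<comment> \<open>\<open>Psi (k + 2)\<close> stands beside a vanishing factor and is left as it
      is; for \<open>k = 1\<close> the induction hypothesis would not reach it.\<close>
    have c2: "cong_beta1 ((psi (int k + 1))\<^sup>2 * Psi (int k + 2) * Psi (int k) - psi (int k + 2) * psi (int k) * (Psi (int k + 1))\<^sup>2)
         (0\<^sup>2 * Psi (int k + 2) * Psi (int k) - ?c (j + 1) * ?c j * (?b j)\<^sup>2)"
      unfolding e by (intro intros IH cong_beta1_refl integral_Psi) (simp_all add: k)
    have q2: "0\<^sup>2 * Psi (int k + 2) * Psi (int k) - ?c (j + 1) * ?c j * (?b j)\<^sup>2 = ?b k"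
      by (cases "even j")
         (simp_all add: k algebra_simps power_mult_distrib d_Psi2_mono_simps,
             (simp_all add: eval_nat_numeral)?)
    show ?thesis using c1 unfolding e2 by (blast intro: cong_beta1_cong[OF c2 q2])
  qed
qed


text \<open>The divisibility by \<open>beta1\<close> behind the integrality of \<open>Omega\<close>:
  once \<open>gen_num\<close> is replaced by \<open>gen_prod\<close>, the closed forms of both sides
  have the same exponents.\<close>

lemma cong_Psi_quotient:
  assumes "n \<ge> 0"
  shows "cong_beta1 (Psi (n + 2) * Psi (n - 1)) (gen_num * (Psi (n + 1) * Psi n))"
proof -
  let ?d = "fgen X1 - fgen X2"
  let ?a = "\<lambda>k. d_Psi2_mono (k * k) (k * (k + 1))"
  let ?b = "\<lambda>k. d_Psi2_mono (k * (k + 1)) ((k + 1) * (k + 1))"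
  have a: "cong_beta1 (Psi (2 * int k + 1)) (?a k)" 
    and b: "cong_beta1 (Psi (2 * int k + 2)) (?b k)" for k
    using cong_Psi by blast+
  note num = cong_beta1_mult[OF cong_gen_num]
  have trans: "cong_beta1 x y" if "cong_beta1 x x'" "cong_beta1 y y'" "x' = y'" for x x' y y'
    using that cong_beta1_trans cong_beta1_sym by blast
  have "n = 0 \<or> n = 1 \<or> n \<ge> 2 \<and> even n \<or> n \<ge> 3 \<and> odd n" using assms by presburger
  \<comment> \<open>For \<open>n\<close> equal to 0 or 1 the indices -1 or 0 occur, to which
    \<open>cong_Psi\<close> does not apply.\<close>
  then consider "n = 0" | "n = 1" | k where "n = 2 * int k + 2" | k where "n = 2 * int k + 3"
  proof (elim disjE conjE)
    assume n: "n \<ge> 2" "even n"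
    then obtain m where "n = 2 * m" by (elim evenE)
    thus ?thesis using that(3)[of "nat (m - 1)"] n by simp
  next
    assume n: "n \<ge> 3" "odd n"
    then obtain m where "n = 2 * m + 1" by (elim oddE)
    thus ?thesis using that(4)[of "nat (m - 1)"] n by simp
  qed (use that in blast)+
  thus ?thesis
  proof cases
    case 1
    thus ?thesis using cong_beta1_sym[OF cong_gen_num] by (simp add: Psi_simps mult.commute)
  next
    case 2
    have "cong_beta1 (Psi 3) (?d * Psi2\<^sup>2)"
      using a[of 1] by (simp add: d_Psi2_mono_def power2_eq_square)
    moreover have "cong_beta1 (gen_num * Psi2) (gen_prod * Psi2)"
      by (intro num cong_beta1_refl integral_Psi2)
    ultimately have "cong_beta1 (Psi 3) (gen_num * Psi2)"
      by (rule trans) (simp add: power2_eq_square)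
    thus ?thesis by (simp add: 2 Psi_simps)
  next
    case 3
    have e: "Psi (n + 2) = Psi (2 * int (k + 1) + 2)" "Psi (n - 1) = Psi (2 * int k + 1)"
      "Psi (n + 1) = Psi (2 * int (k + 1) + 1)" "Psi n = Psi (2 * int k + 2)"
      by (simp_all add: 3 algebra_simps)
    show ?thesis
      unfolding e
      by (rule trans[OF cong_beta1_mult[OF b a] num[OF cong_beta1_mult[OF a b]]])
         (simp only: gen_prod_mono d_Psi2_mono_simps, simp add: algebra_simps)
  next
    case 4
    have e: "Psi (n + 2) = Psi (2 * int (k + 2) + 1)" "Psi (n - 1) = Psi (2 * int k + 2)"
      "Psi (n + 1) = Psi (2 * int (k + 1) + 2)" "Psi n = Psi (2 * int (k + 1) + 1)"
      by (simp_all add: 4 algebra_simps)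
    show ?thesis
      unfolding e
      by (rule trans[OF cong_beta1_mult[OF a b] num[OF cong_beta1_mult[OF b a]]])
         (simp only: gen_prod_mono d_Psi2_mono_simps, simp add: algebra_simps)
  qed
qed

text \<open>The conserved quantity replaces \<open>Psi (n - 2) * (Psi (n + 1))^2\<close> and makes
  the numerator in \<open>Omega_def\<close> visibly twice an element. The 2 is cancelled in the
  fraction field, where it is nonzero, so the formula survives specialization to characteristic
  2.\<close>

lemma beta1_Omega:
  "beta1 * Omega n = beta1 * fgen Y1 * Psi n ^ 3
     + Psi (n - 1) * (Psi (n + 2) * Psi (n - 1) - gen_num * (Psi (n + 1) * Psi n))"
proof -
  have two: "(2::rstar fract) \<noteq> 0"
    by (rule cusp_val_nonzero[OF cusp_val_numeral]) simp
  have "2 * beta1 * Omega n = (Psi (n - 1))\<^sup>2 * Psi (n + 2) - Psi (n - 2) * (Psi (n + 1))\<^sup>2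
      - beta1 * Psi n * (fgen Alpha1 * Phi n + fgen Alpha3 * (Psi n)\<^sup>2)"
    using two beta1_nonzero by (simp add: Omega_def)
  hence "2 * (beta1 * Omega n) = 2 * (beta1 * fgen Y1 * Psi n ^ 3
     + Psi (n - 1) * (Psi (n + 2) * Psi (n - 1) - gen_num * (Psi (n + 1) * Psi n)))"
    using elliptic_seqD(2)[OF elliptic_seq_Psi, of n] gen_inv_eq Phi_def[of n] beta1_def
    by algebra
  thus ?thesis using two by (metis mult_cancel_left)
qed

lemma integral_Omega:
  assumes "n \<ge> 0"
  shows "integral (Omega n)"
proof -
  obtain u where u: "integral u"
    "Psi (n + 2) * Psi (n - 1) = gen_num * (Psi (n + 1) * Psi n) + beta1 * u"
    using cong_Psi_quotient[OF assms] by (elim cong_beta1E)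
  have "beta1 * Omega n = beta1 * (fgen Y1 * Psi n ^ 3 + Psi (n - 1) * u)"
    unfolding beta1_Omega u(2) by (simp add: algebra_simps)
  hence "Omega n = fgen Y1 * Psi n ^ 3 + Psi (n - 1) * u"
    using beta1_nonzero by simp
  thus ?thesis using u(1) by (auto intro!: integral_intros integral_Psi)
qed

section \<open>Multiples of a point\<close>

text \<open>By the choice of \<open>x3\<close>, the curve polynomial on the chord differs from
  \<open>-(x - x1) (x - x2) (x - x3)\<close> by a linear polynomial, so its value at
  \<open>x3\<close> is interpolated from those at \<open>x1\<close> and \<open>x2\<close>. Negation
  does not change the value.\<close>

lemma chord_on_curve:
  fixes E :: "'a::idom weierstrass"
  assumes "weierstrass_poly E x1 y1 = 0" "weierstrass_poly E x2 y2 = 0" "x1 \<noteq> x2"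
    and y2: "y2 = y1 + l * (x2 - x1)"
    and x3: "x3 = l\<^sup>2 + a1 E * l - a2 E - x1 - x2"
  shows "weierstrass_poly E x3 (- (l + a1 E) * x3 - (y1 - l * x1) - a3 E) = 0"
proof -
  have "(x2 - x1) * weierstrass_poly E x3 (- (l + a1 E) * x3 - (y1 - l * x1) - a3 E) =
     weierstrass_poly E x1 y1 * (x2 - x3) + weierstrass_poly E x2 y2 * (x3 - x1)"
    unfolding x3 y2 weierstrass_poly_def by algebra
  thus ?thesis using assms(1-3) by simp
qed

lemma tangent_on_curve:
  fixes E :: "'a::idom weierstrass"
  assumes "weierstrass_poly E x1 y1 = 0" "tangent_den E x1 y1 * l = tangent_num E x1 y1"
    and x3: "x3 = l\<^sup>2 + a1 E * l - a2 E - x1 - x1"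
  shows "weierstrass_poly E x3 (- (l + a1 E) * x3 - (y1 - l * x1) - a3 E) = 0"
proof -
  have "weierstrass_poly E x3 (- (l + a1 E) * x3 - (y1 - l * x1) - a3 E) =
     weierstrass_poly E x1 y1 + (x3 - x1) * (tangent_den E x1 y1 * l - tangent_num E x1 y1)"
    unfolding x3 weierstrass_poly_def tangent_den_def tangent_num_def by algebra
  thus ?thesis using assms(1,2) by simp
qed

text \<open>The coordinates of a multiple of \<open>(x1, y1)\<close> in terms of the values \<open>p\<close> of the division
  polynomials. The usual formula for the second coordinate has the denominator
  \<open>2 * tangent_den\<close>; eliminating one of the two end terms by the second identity of
  \<open>elliptic_seq\<close> removes the factor 2.\<close>

definition divpoly_point :: "'a::field weierstrass \<Rightarrow> 'a \<Rightarrow> 'a \<Rightarrow> (int \<Rightarrow> 'a) \<Rightarrow> int \<Rightarrow> 'a \<Rightarrow> 'a \<Rightarrow> bool" where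
  "divpoly_point E x1 y1 p n x y \<longleftrightarrow> weierstrass_poly E x y = 0 \<and>
     (x1 - x) * (p n)\<^sup>2 = p (n + 1) * p (n - 1) \<and>
     tangent_den E x1 y1 * (y - y1) * p n ^ 3 =
       p (n + 2) * (p (n - 1))\<^sup>2 - tangent_num E x1 y1 * p (n + 1) * p n * p (n - 1)"

text \<open>As \<open>p (n + 1)\<close> is nonzero, equal abscissas force
  \<open>p (n - 1) = 0\<close> and hence \<open>n = 1\<close>; the tangent case of the group law is
  met only there. That the sum lies on the curve comes from the line construction, not from the
  coordinate formulas.\<close>

lemma divpoly_point_add:
  fixes E :: "'a::field weierstrass"
  assumes curve: "weierstrass_poly E x1 y1 = 0"
    and ell: "elliptic_seq ((tangent_den E x1 y1)\<^sup>2) (psi3 E x1) (somos_inv E x1) p"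
    and p: "p 0 = 0" "p 1 = 1" "p 2 = tangent_den E x1 y1" "p 3 = psi3 E x1"
    and n: "n = 1 \<and> x = x1 \<and> y = y1 \<or> p (n - 1) \<noteq> 0"
    and nz: "p n \<noteq> 0" "p (n + 1) \<noteq> 0"
    and pt: "divpoly_point E x1 y1 p n x y"
  shows "\<exists>x3 y3. ec_add E (Affine x1 y1) (Affine x y) = Affine x3 y3 \<and>
     divpoly_point E x1 y1 p (n + 1) x3 y3"
proof -
  define b S where "b = tangent_den E x1 y1" and "S = tangent_num E x1 y1"
  define l where "l = (if x1 = x then S / b else (y - y1) / (x - x1))"
  define x3 where "x3 = l\<^sup>2 + a1 E * l - a2 E - x1 - x"
  define y3 where "y3 = - (l + a1 E) * x3 - (y1 - l * x1) - a3 E"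
  have pt': "weierstrass_poly E x y = 0" "(x1 - x) * (p n)\<^sup>2 = p (n + 1) * p (n - 1)"
    "b * (y - y1) * p n ^ 3 = p (n + 2) * (p (n - 1))\<^sup>2 - S * p (n + 1) * p n * p (n - 1)"
    using pt by (simp_all add: divpoly_point_def b_def S_def)
  \<comment> \<open>These facts have the same form for tangent and chord, so the second coordinate
    is treated once for both.\<close>
  have *: "ec_add E (Affine x1 y1) (Affine x y) = Affine x3 y3 \<and> weierstrass_poly E x3 y3 = 0 \<and>
     b * l = S - (x1 - x) * (x1 - x3) \<and> (x1 - x3) * (p (n + 1))\<^sup>2 = p (n + 2) * p n"
  proof (cases "x1 = x")
    case True
    hence 1: "n = 1" "x = x1" "y = y1" using n nz pt' by auto
    have b: "b \<noteq> 0" using nz 1 p by (simp add: b_def)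
    have l: "l = S / b" using True by (simp add: l_def)
    have bl: "b * l = S" using b unfolding l by simp
    have "\<not> (x1 = x1 \<and> y1 + y1 + a1 E * x1 + a3 E = 0)"
      using b unfolding b_def tangent_den_def by (simp only: mult_2) simp
    hence "ec_add E (Affine x1 y1) (Affine x y) = Affine x3 y3"
      unfolding x3_def y3_def l S_def b_def tangent_num_def tangent_den_def 1 ec_add.simps Let_def
      by (simp only: if_False simp_thms if_True)
    moreover have "weierstrass_poly E x3 y3 = 0"
      unfolding y3_def
      by (rule tangent_on_curve[OF curve]) (use bl in \<open>simp_all add: b_def S_def x3_def 1\<close>)
    moreover have "(x1 - x3) * b\<^sup>2 = psi3 E x1"
    proof -
      have "(x1 - x3) * b\<^sup>2 = b\<^sup>2 * (3 * x1 + a2 E) - (b * l)\<^sup>2 - a1 E * b * (b * l)"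
        unfolding x3_def 1 by algebra
      thus ?thesis
        using psi3_eq[OF curve] unfolding bl b_def[symmetric] S_def[symmetric] by simp
    qed
    ultimately show ?thesis using bl p by (simp add: 1 b_def)
  next
    case False
    hence l: "y = y1 + l * (x - x1)" by (simp add: l_def)
    have "ec_add E (Affine x1 y1) (Affine x y) = Affine x3 y3"
      using False by (simp add: Let_def x3_def y3_def l_def)
    moreover have "weierstrass_poly E x3 y3 = 0"
      unfolding y3_def by (rule chord_on_curve[OF curve pt'(1) False l x3_def])
    moreover have bl: "b * l = S - (x1 - x) * (x1 - x3)"
    proof -
      have "l = (y - y1) / (x - x1)" using False by (simp add: l_def)
      from chord_x_diff[OF curve pt'(1) False this] show ?thesis
        unfolding x3_def b_def S_def by (simp add: algebra_simps)
    qed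
    moreover have "(x1 - x3) * (p (n + 1))\<^sup>2 = p (n + 2) * p n"
    proof -
      have nz': "p (n - 1) \<noteq> 0" using n False by auto
      have "(p (n - 1))\<^sup>2 * ((x1 - x3) * (p (n + 1))\<^sup>2) = (x1 - x3) * (p (n + 1) * p (n - 1))\<^sup>2"
        by algebra
      also have "\<dots> = p n ^ 4 * (x1 - x) * ((x1 - x) * (x1 - x3))"
        unfolding pt'(2)[symmetric] by algebra
      also have "(x1 - x) * (x1 - x3) = S - b * l" using bl by simp
      also have "p n ^ 4 * (x1 - x) * (S - b * l) =
         p n * (S * p n * ((x1 - x) * (p n)\<^sup>2) + b * (l * (x - x1)) * p n ^ 3)"
        by algebra
      also have "l * (x - x1) = y - y1" using l by simp
      also have "p n * (S * p n * ((x1 - x) * (p n)\<^sup>2) + b * (y - y1) * p n ^ 3) =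
         (p (n - 1))\<^sup>2 * (p (n + 2) * p n)"
        unfolding pt'(2,3) by algebra
      finally have "(p (n - 1))\<^sup>2 * ((x1 - x3) * (p (n + 1))\<^sup>2) = (p (n - 1))\<^sup>2 * (p (n + 2) * p n)" .
      thus ?thesis using nz' by simp
    qed
    ultimately show ?thesis by blast
  qed
  hence F: "b * l = S - (x1 - x) * (x1 - x3)" "(x1 - x3) * (p (n + 1))\<^sup>2 = p (n + 2) * p n"
    by blast+
  \<comment> \<open>With this factor the differences of abscissas occur only as
    \<open>(x1 - x) * (p n)^2\<close> and \<open>(x1 - x3) * (p (n + 1))^2\<close>, whose values are
    known.\<close>
  have "p n ^ 2 * p (n + 1) * (b * (y3 - y1) * p (n + 1) ^ 3) =
     p n ^ 2 * p (n + 1) * (p (n + 3) * (p n)\<^sup>2 - S * p (n + 2) * p (n + 1) * p n)"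
  proof -
    have T: "p (n + 3) * (p n)\<^sup>2 =
       (2 * S + a1 E * b) * p (n + 2) * p (n + 1) * p n - b\<^sup>2 * p (n + 1) ^ 3 - p (n - 1) * (p (n + 2))\<^sup>2"
      using elliptic_seqD(2)[OF ell, of "n + 1"]
      unfolding somos_inv_eq[of E x1 y1] S_def[symmetric] b_def[symmetric]
      by (simp add: algebra_simps)
    have y3: "b * (y3 - y1) = - b\<^sup>2 + b * l * (x1 - x3) + a1 E * b * (x1 - x3)"
      unfolding y3_def b_def tangent_den_def by algebra
    have "p n ^ 2 * p (n + 1) * (b * (y3 - y1) * p (n + 1) ^ 3) =
       - b\<^sup>2 * (p n)\<^sup>2 * p (n + 1) ^ 4
       + (S + a1 E * b) * (p n)\<^sup>2 * (p (n + 1))\<^sup>2 * ((x1 - x3) * (p (n + 1))\<^sup>2)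
       - ((x1 - x) * (p n)\<^sup>2) * ((x1 - x3) * (p (n + 1))\<^sup>2)\<^sup>2"
      unfolding y3 F(1) by algebra
    also have "\<dots> = p n ^ 2 * p (n + 1) *
       ((2 * S + a1 E * b) * p (n + 2) * p (n + 1) * p n - b\<^sup>2 * p (n + 1) ^ 3
          - p (n - 1) * (p (n + 2))\<^sup>2 - S * p (n + 2) * p (n + 1) * p n)"
      unfolding F(2) pt'(2) by algebra
    finally show ?thesis unfolding T .
  qed
  hence "b * (y3 - y1) * p (n + 1) ^ 3 = p (n + 3) * (p n)\<^sup>2 - S * p (n + 2) * p (n + 1) * p n"
    using nz by simp
  thus ?thesis
    using * by (auto simp: divpoly_point_def b_def S_def algebra_simps)
qed

text \<open>The last conjunct supplies the alternative for \<open>n = 1\<close> in the hypothesis of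
  \<open>divpoly_point_add\<close>.\<close>

lemma ec_mult_divpoly_point:
  fixes E :: "'a::field weierstrass"
  assumes curve: "weierstrass_poly E x1 y1 = 0"
    and ell: "elliptic_seq ((tangent_den E x1 y1)\<^sup>2) (psi3 E x1) (somos_inv E x1) p"
    and p: "p 0 = 0" "p 1 = 1" "p 2 = tangent_den E x1 y1" "p 3 = psi3 E x1"
    and nz: "\<And>k. 0 < k \<Longrightarrow> k \<le> Suc n \<Longrightarrow> p (int k) \<noteq> 0"
  shows "\<exists>x y. ec_mult E (Suc n) (Affine x1 y1) = Affine x y \<and>
     divpoly_point E x1 y1 p (int (Suc n)) x y \<and> (n = 0 \<longrightarrow> x = x1 \<and> y = y1)"
  using nz
proof (induction n)
  case 0
  show ?case using curve p by (simp add: divpoly_point_def)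
next
  case (Suc n)
  then obtain x y where xy: "ec_mult E (Suc n) (Affine x1 y1) = Affine x y"
     "divpoly_point E x1 y1 p (int (Suc n)) x y" "n = 0 \<longrightarrow> x = x1 \<and> y = y1"
    by force
  have 1: "int (Suc n) = 1 \<and> x = x1 \<and> y = y1 \<or> p (int (Suc n) - 1) \<noteq> 0"
    using xy(3) Suc.prems[of n] by auto
  have 2: "p (int (Suc n)) \<noteq> 0" "p (int (Suc n) + 1) \<noteq> 0"
    using Suc.prems[of "Suc n"] Suc.prems[of "Suc (Suc n)"] by (simp_all add: algebra_simps)
  from divpoly_point_add[OF curve ell p 1 2 xy(2)] obtain x3 y3 where
    "ec_add E (Affine x1 y1) (Affine x y) = Affine x3 y3"
    "divpoly_point E x1 y1 p (int (Suc n) + 1) x3 y3" by blast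
  moreover have "int (Suc n) + 1 = int (Suc (Suc n))" by simp
  ultimately show ?case using xy(1) by (metis ec_mult.simps(2) nat.distinct(1))
qed

text \<open>Before \<open>m\<close> the multiples are affine; at \<open>m - 1\<close> the formulas
  give the negative of the point, so the next addition yields \<open>Infinity\<close>.\<close>

lemma ec_order_eq:
  fixes E :: "'a::field weierstrass"
  assumes curve: "weierstrass_poly E x1 y1 = 0"
    and ell: "elliptic_seq ((tangent_den E x1 y1)\<^sup>2) (psi3 E x1) (somos_inv E x1) p"
    and p: "p 0 = 0" "p 1 = 1" "p 2 = tangent_den E x1 y1" "p 3 = psi3 E x1"
    and m: "m > 0" "p (int m) = 0"
    and nz: "\<And>k. 0 < k \<Longrightarrow> k < m \<Longrightarrow> p (int k) \<noteq> 0"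
  shows "ec_order E (Affine x1 y1) = m"
  unfolding ec_order_def
proof (rule Least_equality)
  fix k assume k: "0 < k \<and> ec_mult E k (Affine x1 y1) = Infinity"
  show "m \<le> k"
  proof (rule ccontr)
    assume "\<not> m \<le> k"
    then obtain n where n: "k = Suc n" "Suc n < m" using k gr0_implies_Suc by auto
    have nz': "p (int j) \<noteq> 0" if "0 < j" "j \<le> Suc n" for j using nz that n by simp
    have "\<exists>x y. ec_mult E (Suc n) (Affine x1 y1) = Affine x y"
      using ec_mult_divpoly_point[OF curve ell p nz', of n] by blast
    thus False using k n by auto
  qed
next
  have "m \<noteq> 1" using m p by auto
  then obtain n where n: "m = Suc (Suc n)" using m by (cases m; cases "m - 1") auto
  have nz': "p (int j) \<noteq> 0" if "0 < j" "j \<le> Suc n" for j using nz that n by simp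
  obtain x y where xy: "ec_mult E (Suc n) (Affine x1 y1) = Affine x y"
     "divpoly_point E x1 y1 p (int (Suc n)) x y" "n = 0 \<longrightarrow> x = x1 \<and> y = y1"
    using ec_mult_divpoly_point[OF curve ell p nz', of n] by blast
  define i where "i = int n"
  have i: "int (Suc n) = i + 1" "p (i + 2) = 0" "p (i + 1) \<noteq> 0"
    using n m(2) nz[of "Suc n"] by (simp_all add: i_def algebra_simps)
  define b where "b = tangent_den E x1 y1"
  have pt: "(x1 - x) * (p (i + 1))\<^sup>2 = 0" "b * (y - y1) * p (i + 1) ^ 3 = p (i + 3) * (p i)\<^sup>2"
  proof -
    have e: "i + 1 + 1 = i + 2" "i + 1 + 2 = i + 3" "i + 1 - 1 = i" by simp_all
    show "(x1 - x) * (p (i + 1))\<^sup>2 = 0" "b * (y - y1) * p (i + 1) ^ 3 = p (i + 3) * (p i)\<^sup>2"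
      using xy(2) unfolding i(1) divpoly_point_def e i(2) b_def by (simp_all only: mult_zero_left mult_zero_right diff_zero)
  qed
  have x: "x = x1" using pt(1) i(3) by simp
  have "y1 + y + a1 E * x + a3 E = 0"
  proof (cases "n = 0")
    case True
    have "p 2 = 0" using i(2) True by (simp add: i_def)
    moreover have "x = x1" "y = y1" using xy(3) True by simp_all
    ultimately show ?thesis using p(3) unfolding tangent_den_def by (simp only: mult_2)
  next
    case False
    have b: "b \<noteq> 0" using nz[of 2] n False p by (simp add: b_def)
    \<comment> \<open>The conserved quantity at \<open>m - 1\<close> loses all terms containing
      \<open>p m\<close>. This leads to \<open>y - y1 = - b\<close>, so \<open>y\<close> is the
      ordinate of the negative.\<close>
    have "p (i + 3) * (p i)\<^sup>2 = - b\<^sup>2 * p (i + 1) ^ 3"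
      using elliptic_seqD(2)[OF ell, of "i + 1"] i by (simp add: b_def algebra_simps)
    hence "b * p (i + 1) ^ 3 * (y - y1 + b) = 0"
      using pt(2) by (simp add: algebra_simps power2_eq_square)
    hence "y - y1 + b = 0" using b i by simp
    thus ?thesis unfolding b_def tangent_den_def x by algebra
  qed
  hence "ec_mult E m (Affine x1 y1) = Infinity" using xy(1) x unfolding n by (simp only: ec_mult.simps(2)) simp
  thus "0 < m \<and> ec_mult E m (Affine x1 y1) = Infinity" using m by blast
qed

text \<open>If no term vanished, the recurrence could be run backwards from a repetition of four
  consecutive terms until it produces a second zero besides \<open>p 0\<close>.\<close>

lemma elliptic_seq_finite_zero:
  fixes p :: "int \<Rightarrow> 'a::{finite, field}"
  assumes ell: "elliptic_seq \<alpha> \<beta> J p" and "p 0 = 0"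
  shows "\<exists>m>0. p (int m) = 0"
proof (rule ccontr)
  assume "\<not> (\<exists>m>0. p (int m) = 0)"
  hence nz: "p (int m) \<noteq> 0" if "m > 0" for m using that by blast
  define w where "w m = (p (int m), p (int m + 1), p (int m + 2), p (int m + 3))" for m
  have "\<not> inj w" using finite_imageD[of w UNIV] by auto
  then obtain i j where ij: "w i = w j" "i < j"
    unfolding inj_def by (metis nat_neq_iff)
  have prev: "w a = w b" if "w (Suc a) = w (Suc b)" for a b
  proof -
    have rec: "p (int n) * p (int n + 4) = \<alpha> * p (int n + 3) * p (int n + 1) - \<beta> * (p (int n + 2))\<^sup>2" for n
      using elliptic_seqD(1)[OF ell, of "int n + 2"] by (simp add: algebra_simps)
    have nz4: "p (int b + 4) \<noteq> 0" using nz[of "b + 4"] by (simp add: algebra_simps)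
    have eq: "p (int a + 1) = p (int b + 1)" "p (int a + 2) = p (int b + 2)"
      "p (int a + 3) = p (int b + 3)" "p (int a + 4) = p (int b + 4)"
      using that by (simp_all add: w_def algebra_simps)
    have "p (int a) * p (int b + 4) = p (int b) * p (int b + 4)"
      using rec[of a] rec[of b] by (simp add: eq)
    thus ?thesis using nz4 eq by (simp add: w_def)
  qed
  have "w 0 = w (j - i)"
    using ij
  proof (induction i arbitrary: j)
    case (Suc i)
    then obtain k where "j = Suc k" by (metis less_nat_zero_code not0_implies_Suc)
    thus ?case using Suc prev[of i k] by simp
  qed simp
  hence "p (int (j - i)) = 0" using \<open>p 0 = 0\<close> by (simp add: w_def)
  thus False using nz[of "j - i"] ij by simp
qed

section \<open>Periodicity\<close>

text \<open>The addition formula for \<open>m = r\<close> and \<open>m = r + 1\<close> shows that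
  the quotient of \<open>A (n + r)\<close> by \<open>A n\<close> gains the fixed factor
  \<open>\<rho> = - v / u\<close> when \<open>n\<close> grows by 2. The recurrence ties the parity
  classes together, so the quotients are geometric with a ratio \<open>b\<close> such that
  \<open>b^2 = \<rho>\<close>.\<close>

lemma elliptic_seq_quasi_periodic:
  fixes A p :: "int \<Rightarrow> 'a::field" and r :: nat
  assumes A: "elliptic_seq \<alpha> \<beta> J A"
    and add: "\<And>n m. A (n + m) * A (n - m) =
       (p m)\<^sup>2 * A (n + 1) * A (n - 1) - p (m + 1) * p (m - 1) * (A n)\<^sup>2"
    and nz: "A (-1) \<noteq> 0" "A 0 \<noteq> 0" "A 1 \<noteq> 0" "\<alpha> \<noteq> 0"
    and p: "p (int r) = 0" "p (int r - 1) \<noteq> 0" "p (int r + 1) \<noteq> 0"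
  shows "\<exists>c b s. c \<noteq> 0 \<and> s \<noteq> 0 \<and> b \<noteq> 0 \<and> b ^ r = s\<^sup>2 \<and>
     (\<forall>k. A (int k - 2 + int r) = c * b ^ k * A (int k - 2))"
proof -
  define R where "R = int r"
  define u v where "u = p (R - 1)" and "v = p (R + 1)"
  have uv: "u \<noteq> 0" "v \<noteq> 0" using p by (simp_all add: u_def v_def R_def)
  define \<rho> where "\<rho> = - v / u"
  have \<rho>: "\<rho> * u = - v" using uv by (simp add: \<rho>_def)
  have e1: "A (n + R) * A (n - R) = - v * u * (A n)\<^sup>2" for n
    using add[of n R] p by (simp add: u_def v_def R_def)
  have e2: "A (n + 2 + R) * A (n - R) = v\<^sup>2 * A (n + 2) * A n" for n
    using add[of "n + 1" "R + 1"] p by (simp add: u_def v_def R_def algebra_simps)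
  have rec: "A (n + 2) * A (n - 2) = \<alpha> * A (n + 1) * A (n - 1) - \<beta> * (A n)\<^sup>2" for n
    by (rule elliptic_seqD(1)[OF A])
  have nzR: "A (n + R) \<noteq> 0" "A (n - R) \<noteq> 0" if "A n \<noteq> 0" for n
    using e1[of n] that uv by auto
  have zR: "A (n + R) = 0" if "A n = 0" for n
    using e1[of "n + R"] that uv by auto
  define C where "C n = A (n + R) / A n" for n
  have C: "A (n + R) = C n * A n" if "A n \<noteq> 0" for n using that by (simp add: C_def)
  have C_nz: "C n \<noteq> 0" if "A n \<noteq> 0" for n using that nzR by (simp add: C_def)
  have two: "C (n + 2) = \<rho> * C n" if n: "A n \<noteq> 0" "A (n + 2) \<noteq> 0" for n
  proof -
    have "v * A n * A (n - R) * (u * A (n + 2 + R) * A n) = v * A n * A (n - R) * (- v * A (n + 2) * A (n + R))"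
      using e1[of n] e2[of n] by algebra
    hence "u * A (n + 2 + R) * A n = - v * A (n + 2) * A (n + R)"
      using uv n nzR(2)[OF n(1)] by (metis mult_left_cancel mult_eq_0_iff)
    hence "A n * A (n + 2) * (u * C (n + 2)) = A n * A (n + 2) * (- v * C n)"
      unfolding C[OF n(1)] C[OF n(2)] by (simp add: mult_ac)
    hence "u * C (n + 2) = - v * C n" using n by (metis mult_left_cancel mult_eq_0_iff)
    thus ?thesis using uv by (simp add: \<rho>_def field_simps)
  qed
  \<comment> \<open>\<open>two\<close> relates only indices of equal parity; comparing the
    recurrences at 0 and at \<open>R\<close> relates \<open>C 0\<close> to its odd
    neighbours.\<close>
  have mid: "C 1 * C (-1) = (C 0)\<^sup>2"
  proof -
    have "A (2 + R) * A (-2 + R) = (C 0)\<^sup>2 * (A 2 * A (-2))"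
    proof (cases "A 2 = 0 \<or> A (-2) = 0")
      case True
      thus ?thesis using zR[of 2] zR[of "-2"] by auto
    next
      case False
      thus ?thesis
        using two[of 0] two[of "-2"] nz C[of 2] C[of "-2"] by (simp add: power2_eq_square)
    qed
    moreover have "A 2 * A (-2) = \<alpha> * A 1 * A (-1) - \<beta> * (A 0)\<^sup>2"
      using rec[of 0] by simp
    moreover have "A (2 + R) * A (-2 + R) = \<alpha> * A (1 + R) * A (-1 + R) - \<beta> * (A (0 + R))\<^sup>2"
      using rec[of R] by (simp add: algebra_simps)
    ultimately have "\<alpha> * A 1 * A (-1) * (C 1 * C (-1)) = \<alpha> * A 1 * A (-1) * (C 0)\<^sup>2"
      unfolding C[OF nz(1)] C[OF nz(2)] C[OF nz(3)] by algebra
    thus ?thesis using nz by simp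
  qed
  define b where "b = C 1 / C 0"
  define c where "c = C (-1)"
  have b: "b \<noteq> 0" "c \<noteq> 0" "C 0 = c * b" "C 1 = b * C 0"
    using mid C_nz[OF nz(1)] C_nz[OF nz(2)] C_nz[OF nz(3)]
    by (simp_all add: b_def c_def field_simps power2_eq_square)
  have b2: "\<rho> = b\<^sup>2"
    using two[of "-1"] nz b by (simp add: c_def power2_eq_square)
  \<comment> \<open>Two adjacent nonzero terms that already follow the geometric law. A zero of
    \<open>A\<close> interrupts the chain of quotients.\<close>
  define good where "good k \<longleftrightarrow> A (int k - 1) \<noteq> 0 \<and> A (int k) \<noteq> 0 \<and>
    C (int k - 1) = c * b ^ k \<and> C (int k) = c * b ^ (k + 1)" for k
  have good0: "good 0" using nz b by (simp add: good_def c_def)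
  have good1: "good (Suc k)" if "good k" "A (int k + 1) \<noteq> 0" for k
    using that two[of "int k - 1"] b2 by (auto simp: good_def power2_eq_square algebra_simps)
  \<comment> \<open>A zero at \<open>k + 1\<close> is jumped over: conserved quantity and recurrence
    make the next two terms nonzero. The chain of \<open>two\<close> being broken at
    \<open>k + 1\<close>, \<open>C (k + 3)\<close> comes from the recurrence around
    \<open>k + 1\<close>.\<close>
  have good3: "good (k + 3)" if g: "good k" and z: "A (int k + 1) = 0" for k
  proof -
    define i where "i = int k"
    have g': "A (i - 1) \<noteq> 0" "A i \<noteq> 0" "C (i - 1) = c * b ^ k" "C i = c * b ^ (k + 1)" and z': "A (i + 1) = 0"
      using g z by (simp_all add: good_def i_def)
    have "A (i + 2) * (A (i - 1))\<^sup>2 = - \<alpha> * A i ^ 3"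
      using elliptic_seqD(2)[OF A, of i] z' by simp
    hence n2: "A (i + 2) \<noteq> 0" using g' nz by auto
    have q: "A (i + 3) * A (i - 1) = \<alpha> * A (i + 2) * A i"
      using rec[of "i + 1"] z' by (simp add: algebra_simps)
    hence n3: "A (i + 3) \<noteq> 0" using n2 g' nz by auto
    have C2: "C (i + 2) = c * b ^ (k + 3)"
      using two[OF g'(2) n2] g' b2 by (simp add: power_add power2_eq_square power3_eq_cube mult_ac)
    have "A (i + 3 + R) * A (i - 1 + R) = \<alpha> * A (i + 2 + R) * A (i + R)"
      using rec[of "i + 1 + R"] zR[OF z'] by (simp add: algebra_simps)
    hence "\<alpha> * A (i + 2) * A i * (C (i + 3) * C (i - 1)) = \<alpha> * A (i + 2) * A i * (C (i + 2) * C i)"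
      unfolding C[OF g'(1)] C[OF g'(2)] C[OF n2] C[OF n3] using q by algebra
    hence "C (i + 3) * C (i - 1) = C (i + 2) * C i"
      using nz n2 g' by simp
    hence "C (i + 3) = c * b ^ (k + 4)"
      unfolding g' C2 using b by (simp add: power_add eval_nat_numeral mult_ac)
    moreover have "int (k + 3) = i + 3" "i + 3 - 1 = i + 2" by (simp_all add: i_def)
    ultimately show ?thesis
      using C2 n2 n3 unfolding good_def by (simp add: add.commute eval_nat_numeral)
  qed
  \<comment> \<open>The other alternatives are the zero itself and the index just behind it.\<close>
  have cover: "good k \<or> (\<exists>j. k = j + 1 \<and> good j \<and> A (int j + 1) = 0) \<or>
      (\<exists>j. k = j + 2 \<and> good j \<and> A (int j + 1) = 0)" for k
  proof (induction k)
    case 0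
    show ?case using good0 by blast
  next
    case (Suc k)
    then consider "good k" | j where "k = j + 1" "good j" "A (int j + 1) = 0"
      | j where "k = j + 2" "good j" "A (int j + 1) = 0" by blast
    thus ?case
    proof cases
      case 1
      thus ?thesis using good1[of k] by auto
    next
      case 2
      thus ?thesis by auto
    next
      case 3
      thus ?thesis using good3[of j] by (simp add: eval_nat_numeral)
    qed
  qed
  have nonneg: "A (int k + R) = c * b ^ (k + 1) * A (int k)" for k
    using cover[of k]
  proof (elim disjE exE conjE)
    assume "good k"
    thus ?thesis using C[of "int k"] by (simp add: good_def)
  next
    fix j assume "k = j + 1" "A (int j + 1) = 0"
    thus ?thesis using zR[of "int k"] by (simp add: add.commute)
  next
    fix j assume j: "k = j + 2" "good j" "A (int j + 1) = 0"
    have "good (k + 1)" using good3[OF j(2,3)] j(1) by (simp add: eval_nat_numeral)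
    thus ?thesis using C[of "int k"] by (simp add: good_def)
  qed
  \<comment> \<open>With \<open>j = k - 2\<close> the factor \<open>c * b ^ (j + 1)\<close> becomes
    \<open>c / b * b ^ k\<close>; the two negative indices are treated separately.\<close>
  have all: "A (int k - 2 + R) = c / b * b ^ k * A (int k - 2)" for k
  proof -
    consider "k = 0" | "k = 1" | j where "k = j + 2"
      by (metis One_nat_def Suc_1 add_2_eq_Suc' not0_implies_Suc)
    thus ?thesis
    proof cases
      case 1
      show ?thesis
      proof (cases "A (-2) = 0")
        case True
        thus ?thesis using zR[of "-2"] 1 by simp
      next
        case False
        have "b\<^sup>2 * C (-2) = c * b" using two[of "-2"] False nz b b2 by simp
        thus ?thesis using C[OF False] b 1 by (simp add: field_simps power2_eq_square)
      qed
    next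
      case 2
      thus ?thesis using C[OF nz(1)] b by (simp add: c_def)
    next
      case 3
      thus ?thesis using nonneg[of j] b by (simp add: power_add)
    qed
  qed
  \<comment> \<open>Two shifts lead from 0 to \<open>2 * r\<close>; comparison with the addition
    formula for \<open>n = m = r\<close> gives
    \<open>b ^ r = - v * u = \<rho> * u^2\<close>.\<close>
  have "b ^ r = (b * u)\<^sup>2"
  proof -
    have nr: "A (int r) \<noteq> 0" using nzR(1)[OF nz(2)] by (simp add: R_def)
    have "A (int r + R) * A 0 = - v * u * (A (int r))\<^sup>2"
      using e1[of "int r"] by (simp add: R_def)
    moreover have "A (int r + R) = c * b ^ (r + 1) * A (int r)" by (rule nonneg)
    moreover have "A (int r) = c * b * A 0" using nonneg[of 0] by (simp add: R_def)
    ultimately have "(c * b * A (int r) * A 0) * b ^ r = (c * b * A (int r) * A 0) * (- v * u)"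
      by (simp add: power2_eq_square mult_ac)
    hence "b ^ r = - v * u" using nr nz b by (metis mult_left_cancel mult_eq_0_iff)
    also have "- v * u = (b * u)\<^sup>2" using \<rho> b2 by algebra
    finally show ?thesis .
  qed
  moreover have "b * u \<noteq> 0" "c / b \<noteq> 0" using b uv by simp_all
  ultimately show ?thesis using all b unfolding R_def by blast
qed

lemma finite_field_power_card:
  fixes x :: "'a::{finite, field}"
  assumes "x \<noteq> 0"
  shows "x ^ (CARD('a) - 1) = 1"
proof -
  let ?S = "UNIV - {0::'a}"
  have "bij_betw ((*) x) ?S ?S"
    by (rule bij_betw_byWitness[where f' = "\<lambda>y. y / x"]) (use assms in auto)
  hence "(\<Prod>y\<in>?S. x * y) = \<Prod>?S" by (rule prod.reindex_bij_betw)
  moreover have "\<Prod>?S \<noteq> 0" by simp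
  ultimately show ?thesis by (simp add: prod.distrib)
qed

text \<open>The factor \<open>b ^ r\<close> acquires the exponent
  \<open>(q - 1) * (q - 2) / 2\<close>, which need not be a multiple of \<open>q - 1\<close>; this
  is why \<open>b ^ r\<close> has to be a square.\<close>

lemma quasi_periodic_imp_periodic:
  fixes V :: "nat \<Rightarrow> 'a::{finite, field}"
  assumes V: "\<And>k. V (k + r) = c * b ^ k * V k"
    and nz: "c \<noteq> 0" "b \<noteq> 0" "s \<noteq> 0" "b ^ r = s\<^sup>2"
  shows "V (k + r * (CARD('a) - 1)) = V k"
proof -
  define N where "N = CARD('a) - 1"
  \<comment> \<open>Each further shift by \<open>r\<close> contributes one more factor
    \<open>b ^ r\<close> than the one before, hence the triangular exponent.\<close>
  have *: "V (k + r * j) = c ^ j * b ^ (j * k) * (b ^ r) ^ (\<Sum>i<j. i) * V k" for j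
  proof (induction j)
    case (Suc j)
    have "V (k + r * Suc j) = c * b ^ (k + r * j) * V (k + r * j)"
      using V[of "k + r * j"] by (simp add: add_ac)
    also have "\<dots> = c ^ Suc j * b ^ (Suc j * k) * (b ^ r) ^ (\<Sum>i<Suc j. i) * V k"
      unfolding Suc.IH by (simp add: power_add algebra_simps flip: power_mult)
    finally show ?case .
  qed simp
  have "2 * (\<Sum>i<N. i) = N * (N - 1)"
    by (induction N) (auto simp: algebra_simps)
  hence "(b ^ r) ^ (\<Sum>i<N. i) = (s ^ N) ^ (N - 1)"
    unfolding nz(4) by (simp flip: power_mult)
  moreover have "c ^ N = 1" "b ^ N = 1" "s ^ N = 1"
    unfolding N_def by (intro finite_field_power_card nz)+
  ultimately show ?thesis using *[of N] unfolding N_def[symmetric] by (simp add: power_mult)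
qed

section \<open>Specialization\<close>

definition good_pair :: "'a::field weierstrass \<Rightarrow> 'a point \<Rightarrow> 'a point \<Rightarrow> bool" where
  "good_pair E P1 P2 \<longleftrightarrow> P1 \<in> points E \<and> P2 \<in> points E \<and> P1 \<noteq> Infinity \<and> P2 \<noteq> Infinity \<and>
     ec_add E P2 P1 \<noteq> Infinity \<and> ec_add E P2 (ec_neg E P1) \<noteq> Infinity"

lemma good_pair_specialization:
  assumes "good_pair E P1 P2"
  shows "is_specialization E P1 P2 (specialization E P1 P2)"
  unfolding specialization_def
  by (rule theI'[OF is_specialization_unique]) (use assms in \<open>simp_all add: good_pair_def\<close>)

lemma value_at_of_rstar: "value_at E P1 P2 (of_rstar x) = specialization E P1 P2 x"
  by (simp add: value_at_def the_of_rstar)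

text \<open>\<open>value_at\<close> picks the element of \<open>R*\<close> by a definite
  description, so compatibility is available on \<open>R*\<close> only; this is what the integrality
  results are for.\<close>

lemma value_at_hom:
  assumes "good_pair E P1 P2" and "integral x"
  shows "integral y \<Longrightarrow> value_at E P1 P2 (x + y) = value_at E P1 P2 x + value_at E P1 P2 y"
    and "integral y \<Longrightarrow> value_at E P1 P2 (x - y) = value_at E P1 P2 x - value_at E P1 P2 y"
    and "integral y \<Longrightarrow> value_at E P1 P2 (x * y) = value_at E P1 P2 x * value_at E P1 P2 y"
    and "value_at E P1 P2 (x ^ n) = value_at E P1 P2 x ^ n"
proof -
  have "ring_homomorphism (specialization E P1 P2)"
    using good_pair_specialization[OF assms(1)] by (simp add: is_specialization_def)
  note h = ring_homomorphismD[OF this]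
  show "integral y \<Longrightarrow> value_at E P1 P2 (x + y) = value_at E P1 P2 x + value_at E P1 P2 y"
    "integral y \<Longrightarrow> value_at E P1 P2 (x - y) = value_at E P1 P2 x - value_at E P1 P2 y"
    "integral y \<Longrightarrow> value_at E P1 P2 (x * y) = value_at E P1 P2 x * value_at E P1 P2 y"
    "value_at E P1 P2 (x ^ n) = value_at E P1 P2 x ^ n"
    using assms(2) unfolding integral_def
    by (auto simp: value_at_of_rstar h simp flip: of_rstar_hom)
qed

lemma value_at_numeral:
  assumes "good_pair E P1 P2"
  shows "value_at E P1 P2 0 = 0" "value_at E P1 P2 1 = 1"
    "value_at E P1 P2 (numeral k) = numeral k"
proof -
  have "ring_homomorphism (specialization E P1 P2)"
    using good_pair_specialization[OF assms(1)] by (simp add: is_specialization_def)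
  note h = ring_homomorphismD[OF this]
  show "value_at E P1 P2 0 = 0" "value_at E P1 P2 1 = 1"
    "value_at E P1 P2 (numeral k) = numeral k"
    using value_at_of_rstar[of E P1 P2 0] value_at_of_rstar[of E P1 P2 1]
      value_at_of_rstar[of E P1 P2 "numeral k"]
    by (simp_all add: h of_rstar_hom)
qed

lemma value_at_fgen:
  assumes "good_pair E P1 P2"
  shows "value_at E P1 P2 (fgen Alpha1) = a1 E" "value_at E P1 P2 (fgen Alpha2) = a2 E"
    "value_at E P1 P2 (fgen Alpha3) = a3 E" "value_at E P1 P2 (fgen Alpha4) = a4 E"
    "value_at E P1 P2 (fgen Alpha6) = a6 E"
    "value_at E P1 P2 (fgen X1) = xcoord P1" "value_at E P1 P2 (fgen Y1) = ycoord P1"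
    "value_at E P1 P2 (fgen X2) = xcoord P2" "value_at E P1 P2 (fgen Y2) = ycoord P2"
  using good_pair_specialization[OF assms]
  by (simp_all add: fgen_def value_at_of_rstar is_specialization_def)

lemmas value_at_simps = value_at_hom value_at_numeral value_at_fgen

section \<open>Values of the sequences at a pair of points\<close>

lemma elliptic_seq_value_at:
  assumes g: "good_pair E P1 P2" and A: "elliptic_seq \<alpha> \<beta> J A"
    and int: "integral \<alpha>" "integral \<beta>" "integral J" "\<And>n. integral (A n)"
  defines "v \<equiv> value_at E P1 P2"
  shows "elliptic_seq (v \<alpha>) (v \<beta>) (v J) (\<lambda>n. v (A n))"
proof -
  note h = value_at_hom[OF g, folded v_def]
  show ?thesis
    unfolding elliptic_seq_def
    using elliptic_seqD[OF A, THEN arg_cong[of _ _ v]]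
    by (simp add: h int integral_intros)
qed

lemma value_at_curve:
  assumes "good_pair E P1 P2"
  shows "value_at E P1 P2 beta1 = tangent_den E (xcoord P1) (ycoord P1)"
    and "value_at E P1 P2 beta2 = psi3 E (xcoord P1)"
    and "value_at E P1 P2 gen_inv = somos_inv E (xcoord P1)"
    and "value_at E P1 P2 gen_num = tangent_num E (xcoord P1) (ycoord P1)"
  unfolding beta1_eq beta2_eq tangent_den_def psi3_def somos_inv_def tangent_num_def
    b2_def b4_def b6_def b8_def curve_of_def weierstrass.simps
  by (simp_all add: value_at_simps[OF assms] integral_intros)

text \<open>Only the factor \<open>beta1\<close> has to be cancelled here, and its value is nonzero
  when the order of \<open>P1\<close> exceeds 3; the denominator \<open>2 * beta1\<close> would be
  lost in characteristic 2.\<close>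

lemma value_at_beta1_Omega:
  assumes g: "good_pair E P1 P2" and "n \<ge> 0"
  defines "v \<equiv> value_at E P1 P2"
  shows "v beta1 * v (Omega n) = v beta1 * ycoord P1 * v (Psi n) ^ 3
     + v (Psi (n - 1)) * (v (Psi (n + 2)) * v (Psi (n - 1)) - v gen_num * (v (Psi (n + 1)) * v (Psi n)))"
proof -
  note h = value_at_hom[OF g, folded v_def] value_at_fgen[OF g, folded v_def]
  show ?thesis
    using beta1_Omega[of n, THEN arg_cong[of _ _ v]] \<open>n \<ge> 0\<close>
    by (simp add: h integral_intros integral_beta1 integral_gen_num integral_Omega integral_Psi)
qed

lemma value_at_Phi:
  assumes g: "good_pair E P1 P2"
  defines "v \<equiv> value_at E P1 P2"
  shows "v (Phi n) = xcoord P1 * (v (Psi n))\<^sup>2 - v (Psi (n + 1)) * v (Psi (n - 1))"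
proof -
  note h = value_at_hom[OF g, folded v_def] value_at_fgen[OF g, folded v_def]
  show ?thesis
    unfolding Phi_def by (simp add: h integral_intros integral_Psi)
qed

lemma value_at_Psi_periodic:
  fixes E :: "'a::{finite, field} weierstrass"
  assumes g: "good_pair E P1 P2" and r: "ec_order E P1 > 3"
  defines "v \<equiv> value_at E P1 P2" and "N \<equiv> int (ec_order E P1 * (CARD('a) - 1))"
  shows "v beta1 \<noteq> 0" and "n \<ge> -2 \<Longrightarrow> v (Psi (n + N)) = v (Psi n)"
proof -
  note h = value_at_hom[OF g, folded v_def] value_at_fgen[OF g, folded v_def]
    value_at_numeral[OF g, folded v_def]
  note c = value_at_curve[OF g, folded v_def]
  define p where "p n = v (psi n)" for n
  define A where "A n = v (Psi n)" for n
  obtain x1 y1 where P1: "P1 = Affine x1 y1" and curve: "weierstrass_poly E x1 y1 = 0"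
    using g by (auto simp: good_pair_def points_def)
  have int: "integral (beta1\<^sup>2)" "integral beta2" "integral gen_inv"
    by (intro integral_intros integral_beta1 integral_beta2 integral_gen_inv)+
  have ellA: "elliptic_seq (v (beta1\<^sup>2)) (v beta2) (v gen_inv) A"
    unfolding A_def v_def by (rule elliptic_seq_value_at[OF g elliptic_seq_Psi int integral_Psi])
  have ellp: "elliptic_seq (v (beta1\<^sup>2)) (v beta2) (v gen_inv) p"
    unfolding p_def v_def by (rule elliptic_seq_value_at[OF g elliptic_seq_psi int integral_psi])
  have ellp': "elliptic_seq ((tangent_den E x1 y1)\<^sup>2) (psi3 E x1) (somos_inv E x1) p"
    using ellp by (simp add: h c P1 integral_beta1)
  have p: "p 0 = 0" "p 1 = 1" "p 2 = tangent_den E x1 y1" "p 3 = psi3 E x1"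
    by (simp_all add: p_def divpoly_int_simps h c P1)
  \<comment> \<open>The least positive zero of the specialized \<open>psi\<close>, which
    \<open>ec_order_eq\<close> identifies with the order of \<open>P1\<close>.\<close>
  define m where "m = (LEAST m. m > 0 \<and> p (int m) = 0)"
  have m: "m > 0 \<and> p (int m) = 0"
    unfolding m_def using elliptic_seq_finite_zero[OF ellp p(1)] by (rule LeastI_ex)
  have pnz: "p (int k) \<noteq> 0" if "0 < k" "k < m" for k
    using that not_less_Least[of k "\<lambda>m. m > 0 \<and> p (int m) = 0"] by (auto simp: m_def)
  have order: "ec_order E P1 = m"
    unfolding P1 using ec_order_eq[OF curve ellp' p] m pnz by blast
  hence m3: "m > 3" using r by simp
  have p2: "p 2 \<noteq> 0" using pnz[of 2] m3 by simp
  show b1: "v beta1 \<noteq> 0" using p2 p by (simp add: c P1)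
  have pm: "p (int m - 1) \<noteq> 0"
    using pnz[of "m - 1"] m3 by (simp add: of_nat_diff)
  \<comment> \<open>Two adjacent zeros would leave only the multiple \<open>beta1^2\<close> of
    \<open>p (m - 1) ^ 3\<close> in the conserved quantity at \<open>m - 1\<close>.\<close>
  have pm1: "p (int m + 1) \<noteq> 0"
  proof
    assume "p (int m + 1) = 0"
    hence "v (beta1\<^sup>2) * p (int m - 1) ^ 3 = 0"
      using elliptic_seqD(2)[OF ellp, of "int m - 1"] m by (simp add: algebra_simps)
    thus False using pm b1 by (simp add: h integral_beta1)
  qed
  have add: "A (n + i) * A (n - i) = (p i)\<^sup>2 * A (n + 1) * A (n - 1) - p (i + 1) * p (i - 1) * (A n)\<^sup>2" for n i
    using Psi_addition[of n i, THEN arg_cong[of _ _ v]]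
    by (simp add: h A_def p_def integral_intros integral_psi integral_Psi)
  have x12: "xcoord P1 \<noteq> xcoord P2"
    using xcoord_neq[of P1 E P2] g by (simp add: good_pair_def)
  have nz: "A (-1) \<noteq> 0" "A 0 \<noteq> 0" "A 1 \<noteq> 0" "v (beta1\<^sup>2) \<noteq> 0"
    using x12 b1 p2 p by (simp_all add: A_def Psi_simps h integral_intros integral_beta1 c P1)
  obtain c b s where cbs: "c \<noteq> 0" "s \<noteq> 0" "b \<noteq> 0" "b ^ m = s\<^sup>2"
    "\<And>k. A (int k - 2 + int m) = c * b ^ k * A (int k - 2)"
    using elliptic_seq_quasi_periodic[OF ellA add nz _ pm pm1] m by blast
  have per: "A (int k - 2 + N) = A (int k - 2)" for k
  proof -
    have "A (int (j + m) - 2) = c * b ^ j * A (int j - 2)" for j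
      using cbs(5)[of j] by (simp add: algebra_simps)
    moreover have "int k - 2 + N = int (k + m * (CARD('a) - 1)) - 2"
      by (simp add: N_def order del: of_nat_mult)
    ultimately show ?thesis
      using quasi_periodic_imp_periodic[where V = "\<lambda>k. A (int k - 2)", OF _ cbs(1,3,2,4), of k]
      by (simp only:)
  qed
  show "v (Psi (n + N)) = v (Psi n)" if "n \<ge> -2"
    using per[of "nat (n + 2)"] that by (simp add: A_def)
qed

theorem theorem1p1:
  fixes E :: "'a::{finite, field} weierstrass" and P1 P2 :: "'a point" and q r :: nat
  assumes "q = CARD('a)"
    and "elliptic_curve E"
    and "P1 \<in> points E" and "P2 \<in> points E"
    and "P1 \<noteq> Infinity" and "P2 \<noteq> Infinity"
    and "ec_add E P2 P1 \<noteq> Infinity" and "ec_add E P2 (ec_neg E P1) \<noteq> Infinity"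
    and "ec_order E P1 = r" and "r > 3"
  shows "\<exists>t t' t''. t dvd q - 1 \<and> t' dvd q - 1 \<and> t'' dvd q - 1 \<and>
    purely_periodic (\<lambda>n. value_at E P1 P2 (Psi (int n))) (r * t) \<and>
    purely_periodic (\<lambda>n. value_at E P1 P2 (Phi (int n))) (r * t') \<and>
    purely_periodic (\<lambda>n. value_at E P1 P2 (Omega (int n))) (r * t'')"
proof -
  have g: "good_pair E P1 P2" using assms by (simp add: good_pair_def)
  define v where "v = value_at E P1 P2"
  define N where "N = r * (q - 1)"
  \<comment> \<open>A field has at least two elements, so the period is positive.\<close>
  have "card {0, 1 :: 'a} \<le> CARD('a)" by (rule card_mono) simp_all
  hence N: "N \<ge> 1" using assms(1,10) by (simp add: N_def)
  have b1: "v beta1 \<noteq> 0"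
    using value_at_Psi_periodic(1)[OF g] assms(9,10) by (simp add: v_def)
  have per: "v (Psi (n + int N)) = v (Psi n)" if "n \<ge> -2" for n
    using value_at_Psi_periodic(2)[OF g _ that] assms(1,9,10) by (simp add: v_def N_def)
  have per': "v (Psi (n + int N - 1)) = v (Psi (n - 1))"
    "v (Psi (n + int N + 1)) = v (Psi (n + 1))" "v (Psi (n + int N + 2)) = v (Psi (n + 2))"
    if "n \<ge> 0" for n
    using per[of "n - 1"] per[of "n + 1"] per[of "n + 2"] that by (simp_all add: algebra_simps)
  have Phi: "v (Phi (n + int N)) = v (Phi n)" if "n \<ge> 0" for n
    using that unfolding v_def value_at_Phi[OF g] by (simp add: per per' flip: v_def)
  have "v beta1 * v (Omega (n + int N)) = v beta1 * v (Omega n)" if "n \<ge> 0" for n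
    using that value_at_beta1_Omega[OF g, of n, folded v_def]
      value_at_beta1_Omega[OF g, of "n + int N", folded v_def] by (simp add: per per')
  hence Omega: "v (Omega (n + int N)) = v (Omega n)" if "n \<ge> 0" for n
    using that b1 by simp
  have "purely_periodic (\<lambda>n. v (Psi (int n))) N" "purely_periodic (\<lambda>n. v (Phi (int n))) N"
    "purely_periodic (\<lambda>n. v (Omega (int n))) N"
    using N by (simp_all add: purely_periodic_def per Phi Omega)
  thus ?thesis
    unfolding v_def N_def by (intro exI[of _ "q - 1"] conjI dvd_refl)
qed

end
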